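(* Let $\Omega\subset\mathbb{R}^3$ be a nonempty bounded open set. For every $q_1,q_2,q_3\in(0,1)$ and every $G\in GL(3)$, let $A\in\mathbb{M}^{3\times 3}$ be defined by $$A=\frac{1}{q_3}\left[\left(1-\prod_{i=1}^3(1-q_i)\right)G^{-1}\begin{pmatrix}\lambda_1&0&0\\0&\lambda_2&0\\0&0&\lambda_3\end{pmatrix}G-q_2(1-q_3)I\right],$$ where $$\lambda_1=0,\qquad \lambda_2=\frac{1}{1-q_1},\qquad \lambda_3=\frac{q_2}{q_1+q_2-q_1q_2}.$$ Then, for every $M\in\mathbb{M}^{3\times 3}$ and every $N\in GL(3)$, the set $$K=\{M,\;N+M,\;NA+M\}$$ is non-rigid for approximate solutions.
   Context: $\mathbb{M}^{3\times3}$ is the set of real $3\times3$ matrices, $GL(3)$ the set of invertible real $3\times 3$ matrices, and $I$ the identity matrix. For a matrix field $B$, $\operatorname{Div}B$ denotes the vector of distributional divergences of the rows of $B$. A set $K\subset\mathbb{M}^{3\times 3}$ is non-rigid for approximate solutions (on $\Omega$) if there exists a uniformly bounded sequence $\{B_h\}\subset L^\infty(\Omega,\mathbb{M}^{3\times3})$ such that (i) $\operatorname{Div}B_h\to0$ in $W^{-1,\infty}(\Omega,\mathbb{R}^3)$; (ii) $\operatorname{dist}(B_h,K)\to0$ in measure; (iii) for every $A'\in K$, $\operatorname{dist}(B_h,A')\not\to0$ in measure. *)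

theory Defs
  imports "HOL-Analysis.Analysis"
begin

definition partial_deriv :: "3 \<Rightarrow> (real^3 \<Rightarrow> real) \<Rightarrow> real^3 \<Rightarrow> real" where
  "partial_deriv j \<phi> x = frechet_derivative \<phi> (at x) (axis j 1)"

definition grad :: "(real^3 \<Rightarrow> real) \<Rightarrow> real^3 \<Rightarrow> real^3" where
  "grad \<phi> x = (\<chi> j. partial_deriv j \<phi> x)"

text \<open>Smoothness: every iterated partial derivative (the function itself for the empty list
  of indices) is differentiable everywhere.\<close>

definition smooth :: "(real^3 \<Rightarrow> real) \<Rightarrow> bool" where
  "smooth \<phi> \<longleftrightarrow> (\<forall>js. foldr partial_deriv js \<phi> differentiable_on UNIV)"

definition test_functions :: "(real^3) set \<Rightarrow> (real^3 \<Rightarrow> real) set" where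
  "test_functions \<Omega> =
    {\<phi>. smooth \<phi> \<and> compact (closure {x. \<phi> x \<noteq> 0}) \<and> closure {x. \<phi> x \<noteq> 0} \<subseteq> \<Omega>}"

definition W11_norm :: "(real^3) set \<Rightarrow> (real^3 \<Rightarrow> real) \<Rightarrow> real" where
  "W11_norm \<Omega> \<phi> =
    integral\<^sup>L (lebesgue_on \<Omega>) (\<lambda>x. \<bar>\<phi> x\<bar>) + integral\<^sup>L (lebesgue_on \<Omega>) (\<lambda>x. norm (grad \<phi> x))"

text \<open>The row-wise distributional divergence of a matrix field, as a vector-valued distribution.
  In \<open>B x $ i $ j\<close> the index \<open>i\<close> is the row, so the \<open>i\<close>-th component is
  \<open>\<phi> \<mapsto> - \<integral>\<^sub>\<Omega> \<Sum>\<^sub>j B\<^sub>i\<^sub>j \<partial>\<^sub>j\<phi>\<close>.\<close>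

definition Div :: "(real^3) set \<Rightarrow> (real^3 \<Rightarrow> real^3^3) \<Rightarrow> (real^3 \<Rightarrow> real) \<Rightarrow> real^3" where
  "Div \<Omega> B \<phi> = (\<chi> i. - integral\<^sup>L (lebesgue_on \<Omega>) (\<lambda>x. \<Sum>j\<in>UNIV. B x $ i $ j * partial_deriv j \<phi> x))"

text \<open>The norm of \<open>W\<^sup>-\<^sup>1\<^sup>,\<^sup>\<infinity>(\<Omega>, \<real>\<^sup>3)\<close>, the dual of \<open>W\<^sub>0\<^sup>1\<^sup>,\<^sup>1(\<Omega>)\<close>. Since the latter is the
  \<open>W\<^sup>1\<^sup>,\<^sup>1\<close>-closure of the test functions, it suffices to take the supremum over test functions.
  The values are in \<open>ennreal\<close>: the norm is infinite for distributions outside the space.\<close>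

definition Wneg1inf_norm :: "(real^3) set \<Rightarrow> ((real^3 \<Rightarrow> real) \<Rightarrow> real^3) \<Rightarrow> ennreal" where
  "Wneg1inf_norm \<Omega> T = (SUP \<phi>\<in>{\<phi> \<in> test_functions \<Omega>. W11_norm \<Omega> \<phi> \<le> 1}. ennreal (norm (T \<phi>)))"

definition tendsto_zero_in_measure :: "(real^3) set \<Rightarrow> (nat \<Rightarrow> real^3 \<Rightarrow> real) \<Rightarrow> bool" where
  "tendsto_zero_in_measure \<Omega> f \<longleftrightarrow>
    (\<forall>\<epsilon>>0. (\<lambda>h. emeasure (lebesgue_on \<Omega>) {x \<in> \<Omega>. \<bar>f h x\<bar> > \<epsilon>}) \<longlonglongrightarrow> 0)"

definition uniformly_bounded_Linf :: "(real^3) set \<Rightarrow> (nat \<Rightarrow> real^3 \<Rightarrow> real^3^3) \<Rightarrow> bool" where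
  "uniformly_bounded_Linf \<Omega> B \<longleftrightarrow>
    (\<forall>h. B h \<in> borel_measurable (lebesgue_on \<Omega>)) \<and>
    (\<exists>C. \<forall>h. AE x in lebesgue_on \<Omega>. norm (B h x) \<le> C)"

text \<open>The definition is meant for nonempty \<open>K\<close> (\<open>infdist\<close> to the empty set is \<open>0\<close>). The matrix
  distance is the one of the Frobenius norm.\<close>

definition non_rigid_approx :: "(real^3) set \<Rightarrow> (real^3^3) set \<Rightarrow> bool" where
  "non_rigid_approx \<Omega> K \<longleftrightarrow>
    (\<exists>B. uniformly_bounded_Linf \<Omega> B \<and>
      (\<lambda>h. Wneg1inf_norm \<Omega> (Div \<Omega> (B h))) \<longlonglongrightarrow> 0 \<and>
      tendsto_zero_in_measure \<Omega> (\<lambda>h x. infdist (B h x) K) \<and>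
      (\<forall>A'\<in>K. \<not> tendsto_zero_in_measure \<Omega> (\<lambda>h x. dist (B h x) A')))"

definition diag_matrix :: "real^3 \<Rightarrow> real^3^3" where
  "diag_matrix v = (\<chi> i j. if i = j then v $ i else 0)"

end

theory Submission
  imports Defs "HOL-Real_Asymp.Real_Asymp"
begin

text \<open>
  Let \<open>\<Lambda> = G\<^sup>-\<^sup>1 diag(\<lambda>\<^sub>1, \<lambda>\<^sub>2, \<lambda>\<^sub>3) G\<close>, with eigenvectors \<open>v\<^sub>i = G\<^sup>-\<^sup>1 e\<^sub>i\<close>, and \<open>P\<^sub>1 = N\<Lambda> + M\<close>. The
  formula for \<open>A\<close> says that \<open>P\<^sub>1\<close> arises from itself by three successive mixtures:
  \<open>P\<^sub>1 = q\<^sub>3 (NA + M) + (1 - q\<^sub>3) P\<^sub>2\<close>, \<open>P\<^sub>2 = q\<^sub>2 (N + M) + (1 - q\<^sub>2) P\<^sub>3\<close> and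
  \<open>P\<^sub>3 = q\<^sub>1 M + (1 - q\<^sub>1) P\<^sub>1\<close>. The eigenvalues are such that the two matrices mixed in each step
  agree on one of the \<open>v\<^sub>i\<close>: the differences \<open>P\<^sub>2 - (NA + M)\<close>, \<open>P\<^sub>3 - (N + M)\<close> and \<open>P\<^sub>1 - M\<close>
  annihilate \<open>v\<^sub>3\<close>, \<open>v\<^sub>2\<close> and \<open>v\<^sub>1\<close>. A field that takes two values in layers with normal \<open>n\<close> is divergence
  free (row by row) if the difference of the values annihilates \<open>n\<close>. So each mixture is realised by
  layers, and since the cycle returns to \<open>P\<^sub>1\<close>, the part of the field not yet in \<open>K\<close> can be split
  again and again, on finer and finer scales. Its volume decreases geometrically, while the average
  of the field remains \<open>P\<^sub>1\<close>, which is not in \<open>K\<close>.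

  The layers of one step lie inside those of the step before, and cutting them off there destroys
  the divergence constraint. Therefore all transitions are smooth (\<open>switching_profile_exists\<close>): with
  a weight \<open>f\<close> from the earlier steps, the new term \<open>f \<theta>(s n\<bullet>x + u) C\<close>, where \<open>C n = 0\<close> and \<open>\<theta>\<close>
  has nearly mean zero, has a divergence that tends to zero in \<open>W\<^sup>-\<^sup>1\<^sup>,\<^sup>\<infinity>\<close> as the frequency \<open>s\<close>
  grows, up to the error of the mean (\<open>oscillating_divergence_bound\<close>). The volume fractions are
  not computed: averaged over the phase \<open>u\<close> they have the right value, so some phase is at least as
  good as the average (\<open>exists_phase_below_mean\<close>). One such step is \<open>stage_Suc\<close>; iterating it gives
  \<open>approximating_field\<close>. The resulting bounded sequence tends to \<open>P\<^sub>1\<close> when integrated against a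
  bump function, so it cannot converge in measure to a matrix of \<open>K\<close> (\<open>non_rigid\<close>).
\<close>

section \<open>Functions with bounded continuous derivatives\<close>

text \<open>The gradient is an argument, because the estimates below need it in closed form for
  products and for ridge functions \<open>c (s * (n \<bullet> x) + u)\<close>.\<close>

definition bounded_C1 :: "('a::euclidean_space \<Rightarrow> real) \<Rightarrow> ('a \<Rightarrow> 'a) \<Rightarrow> bool" where
  "bounded_C1 f F \<longleftrightarrow> bounded (range f) \<and> bounded (range F) \<and> continuous_on UNIV F \<and>
     (\<forall>x. (f has_derivative (\<lambda>h. F x \<bullet> h)) (at x))"

text \<open>Second derivatives are only ever taken after fixing a first direction \<open>c\<close>; encoding them as
  gradients of \<open>F x \<bullet> c\<close> makes the product rule for second derivatives a consequence of the one
  for first derivatives.\<close>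

definition bounded_C2 :: "('a::euclidean_space \<Rightarrow> real) \<Rightarrow> ('a \<Rightarrow> 'a) \<Rightarrow> bool" where
  "bounded_C2 f F \<longleftrightarrow> bounded_C1 f F \<and> (\<forall>c. \<exists>H. bounded_C1 (\<lambda>x. F x \<bullet> c) H)"

lemma bounded_C1_continuous: "bounded_C1 f F \<Longrightarrow> continuous_on S f"
  unfolding bounded_C1_def
  by (meson continuous_at_imp_continuous_on has_derivative_continuous)

lemma bounded_C1_bound:
  assumes "bounded_C1 f F"
  obtains K where "K > 0" "\<And>x. \<bar>f x\<bar> \<le> K" "\<And>x. norm (F x) \<le> K"
proof -
  obtain a b where a: "\<And>x. norm (f x) \<le> a" and b: "\<And>x. norm (F x) \<le> b"
    using assms unfolding bounded_C1_def bounded_iff by auto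
  show ?thesis
    by (rule that[of "max 1 (max a b)"]) (use a b in \<open>auto simp: le_max_iff_disj\<close>)
qed

lemma bounded_range_mult:
  fixes f :: "'a \<Rightarrow> real" and G :: "'a \<Rightarrow> 'b::real_normed_vector"
  assumes "bounded (range f)" "bounded (range G)"
  shows "bounded (range (\<lambda>x. f x *\<^sub>R G x))"
proof -
  obtain a b where a: "\<And>x. norm (f x) \<le> a" and b: "\<And>x. norm (G x) \<le> b"
    using assms unfolding bounded_iff by auto
  have "norm (f x *\<^sub>R G x) \<le> a * b" for x
    using mult_mono[OF a b, of x x] order_trans[OF norm_ge_zero a[of x]] by simp
  then show ?thesis unfolding bounded_iff by auto
qed

lemma bounded_C1_mult:
  assumes f: "bounded_C1 f F" and g: "bounded_C1 g G"
  shows "bounded_C1 (\<lambda>x. f x * g x) (\<lambda>x. f x *\<^sub>R G x + g x *\<^sub>R F x)"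
proof -
  have "bounded (range (\<lambda>x. f x * g x))"
    using bounded_range_mult[of f g] f g by (simp add: bounded_C1_def)
  moreover have "bounded (range (\<lambda>x. f x *\<^sub>R G x + g x *\<^sub>R F x))"
    using bounded_range_mult[of f G] bounded_range_mult[of g F] f g
    by (auto simp: bounded_C1_def intro!: bounded_plus_comp)
  moreover have "continuous_on UNIV (\<lambda>x. f x *\<^sub>R G x + g x *\<^sub>R F x)"
    using f g bounded_C1_continuous[OF f, of UNIV] bounded_C1_continuous[OF g, of UNIV]
    by (auto simp: bounded_C1_def intro!: continuous_intros)
  moreover have "((\<lambda>x. f x * g x) has_derivative (\<lambda>h. (f x *\<^sub>R G x + g x *\<^sub>R F x) \<bullet> h)) (at x)" for x
    using f g unfolding bounded_C1_def
    by (auto intro!: derivative_eq_intros simp: inner_simps algebra_simps)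
  ultimately show ?thesis by (simp add: bounded_C1_def)
qed

lemma bounded_C1_add:
  assumes f: "bounded_C1 f F" and g: "bounded_C1 g G"
  shows "bounded_C1 (\<lambda>x. f x + g x) (\<lambda>x. F x + G x)"
  using assms unfolding bounded_C1_def
  by (auto intro!: derivative_eq_intros bounded_plus_comp continuous_intros simp: inner_simps)

lemma bounded_C2_mult:
  assumes f: "bounded_C2 f F" and g: "bounded_C2 g G"
  shows "bounded_C2 (\<lambda>x. f x * g x) (\<lambda>x. f x *\<^sub>R G x + g x *\<^sub>R F x)"
proof -
  have "\<exists>H. bounded_C1 (\<lambda>x. (f x *\<^sub>R G x + g x *\<^sub>R F x) \<bullet> c) H" for c
  proof -
    obtain H1 H2 where H: "bounded_C1 (\<lambda>x. F x \<bullet> c) H1" "bounded_C1 (\<lambda>x. G x \<bullet> c) H2"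
      using f g unfolding bounded_C2_def by blast
    have "bounded_C1 f F" "bounded_C1 g G" using f g by (auto simp: bounded_C2_def)
    from bounded_C1_add[OF bounded_C1_mult[OF this(1) H(2)] bounded_C1_mult[OF this(2) H(1)]]
    show ?thesis by (auto simp: inner_simps)
  qed
  then show ?thesis
    using bounded_C1_mult[of f F g G] f g unfolding bounded_C2_def by blast
qed

lemma bounded_C1_ridge:
  fixes n :: "'a::euclidean_space"
  assumes d: "\<And>t. (c has_real_derivative c' t) (at t)"
    and b: "bounded (range c)" "bounded (range c')" and cont: "continuous_on UNIV c'"
  shows "bounded_C1 (\<lambda>x. c (s * (n \<bullet> x) + u)) (\<lambda>x. (s * c' (s * (n \<bullet> x) + u)) *\<^sub>R n)"
proof -
  have "bounded (range (\<lambda>x. c (s * (n \<bullet> x) + u)))"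
    by (rule bounded_subset[OF b(1)]) auto
  moreover have "bounded (range (\<lambda>x. (s * c' (s * (n \<bullet> x) + u)) *\<^sub>R n))"
  proof -
    have "bounded (range (\<lambda>x. c' (s * (n \<bullet> x) + u)))"
      by (rule bounded_subset[OF b(2)]) auto
    then have "bounded (range (\<lambda>x. c' (s * (n \<bullet> x) + u) *\<^sub>R (s *\<^sub>R n)))"
      by (rule bounded_range_mult) (simp add: image_constant_conv)
    then show ?thesis by (simp add: mult.commute)
  qed
  moreover have "continuous_on UNIV (\<lambda>x. (s * c' (s * (n \<bullet> x) + u)) *\<^sub>R n)"
    by (intro continuous_intros continuous_on_compose2[OF cont]) auto
  moreover have "((\<lambda>x. c (s * (n \<bullet> x) + u)) has_derivative
      (\<lambda>h. ((s * c' (s * (n \<bullet> x) + u)) *\<^sub>R n) \<bullet> h)) (at x)" for x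
  proof -
    have "((\<lambda>x. s * (n \<bullet> x) + u) has_derivative (\<lambda>h. s * (n \<bullet> h))) (at x)"
      by (auto intro!: derivative_eq_intros)
    from has_derivative_compose[OF this d[unfolded has_field_derivative_def]]
    show ?thesis by (simp add: algebra_simps)
  qed
  ultimately show ?thesis by (simp add: bounded_C1_def)
qed

lemma bounded_C2_ridge:
  fixes n :: "'a::euclidean_space"
  assumes "\<And>t. (c has_real_derivative c' t) (at t)" "\<And>t. (c' has_real_derivative c'' t) (at t)"
    and "bounded (range c)" "bounded (range c')" "bounded (range c'')" "continuous_on UNIV c''"
  shows "bounded_C2 (\<lambda>x. c (s * (n \<bullet> x) + u)) (\<lambda>x. (s * c' (s * (n \<bullet> x) + u)) *\<^sub>R n)"
proof -
  have cont': "continuous_on UNIV c'"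
    using assms(2) by (meson DERIV_isCont continuous_at_imp_continuous_on)
  have "\<exists>H. bounded_C1 (\<lambda>x. ((s * c' (s * (n \<bullet> x) + u)) *\<^sub>R n) \<bullet> v) H" for v
  proof -
    have 1: "((\<lambda>t. (s * (n \<bullet> v)) * c' t) has_real_derivative (s * (n \<bullet> v)) * c'' t) (at t)" for t
      using assms(2) by (auto intro!: derivative_eq_intros)
    have 2: "bounded (range (\<lambda>t. (s * (n \<bullet> v)) * c' t))" "bounded (range (\<lambda>t. (s * (n \<bullet> v)) * c'' t))"
      using bounded_range_mult[of "\<lambda>_. s * (n \<bullet> v)" c'] bounded_range_mult[of "\<lambda>_. s * (n \<bullet> v)" c''] assms
      by (auto simp: image_constant_conv)
    have 3: "continuous_on UNIV (\<lambda>t. (s * (n \<bullet> v)) * c'' t)"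
      using assms(6) by (intro continuous_intros) auto
    have "(\<lambda>x. ((s * c' (s * (n \<bullet> x) + u)) *\<^sub>R n) \<bullet> v) = (\<lambda>x. s * (n \<bullet> v) * c' (s * (n \<bullet> x) + u))"
      by (simp add: fun_eq_iff)
    with bounded_C1_ridge[OF 1 2 3, of s n u] show ?thesis
      by metis
  qed
  then show ?thesis using bounded_C1_ridge[of c c' s n u] assms cont'
    by (auto simp: bounded_C2_def)
qed

section \<open>Integration by parts and oscillating factors\<close>

lemma bounded_C1_lipschitz:
  assumes "bounded_C1 f F" and K: "\<And>x. norm (F x) \<le> K"
  shows "\<bar>f x - f y\<bar> \<le> K * norm (x - y)"
proof -
  have "norm (f x - f y) \<le> K * norm (x - y)"
  proof (rule differentiable_bound[of UNIV f "\<lambda>x h. F x \<bullet> h"])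
    fix x show "onorm (\<lambda>h. F x \<bullet> h) \<le> K"
      by (rule order_trans[OF onorm_bound[of "norm (F x)"]])
        (use K Cauchy_Schwarz_ineq2 in auto)
  qed (use assms in \<open>auto simp: bounded_C1_def\<close>)
  then show ?thesis by simp
qed

lemma lborel_integral_translate:
  fixes g :: "'a::euclidean_space \<Rightarrow> real"
  assumes [measurable]: "g \<in> borel_measurable borel"
  shows "(\<integral>x. g (x + v) \<partial>lborel) = (\<integral>x. g x \<partial>lborel)"
    and "integrable lborel g \<Longrightarrow> integrable lborel (\<lambda>x. g (x + v))"
proof -
  have *: "lborel = distr lborel borel (\<lambda>x. v + x)" by (rule lborel_distr_plus[symmetric])
  have "(\<integral>x. g x \<partial>lborel) = (\<integral>x. g x \<partial>distr lborel borel (\<lambda>x. v + x))" using * by simp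
  also have "\<dots> = (\<integral>x. g (v + x) \<partial>lborel)" by (rule integral_distr) auto
  finally show "(\<integral>x. g (x + v) \<partial>lborel) = (\<integral>x. g x \<partial>lborel)" by (simp add: add.commute)
  assume "integrable lborel g"
  then have "integrable (distr lborel borel (\<lambda>x. v + x)) g" using * by simp
  then show "integrable lborel (\<lambda>x. g (x + v))"
    by (subst (asm) integrable_distr_eq) (auto simp: add.commute)
qed

lemma integrable_bounded_support:
  fixes g :: "'a::euclidean_space \<Rightarrow> real"
  assumes "g \<in> borel_measurable borel" "\<And>x. \<bar>g x\<bar> \<le> K" "bounded S" "\<And>x. x \<notin> S \<Longrightarrow> g x = 0"
  shows "integrable lborel g"
proof -
  obtain r where r: "S \<subseteq> cball 0 r" using bounded_subset_ballD[OF assms(3)] ball_subset_cball by blast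
  have "integrable lborel (\<lambda>x::'a. indicator (cball 0 r) x *\<^sub>R K)"
    using emeasure_bounded_finite[of "cball (0::'a) r"]
    by (intro integrable_scaleR_left impI integrable_real_indicator) auto
  then show ?thesis
  proof (rule Bochner_Integration.integrable_bound)
    show "AE x in lborel. norm (g x) \<le> norm (indicator (cball 0 r) x *\<^sub>R K)"
    proof (rule AE_I2)
      fix x
      show "norm (g x) \<le> norm (indicator (cball 0 r) x *\<^sub>R K)"
        using assms(2)[of x] assms(4)[of x] r by (cases "x \<in> S") (auto simp: indicator_def)
    qed
  qed (use assms in simp)
qed

text \<open>The integral of \<open>g\<close> does not change under translation; differentiating in the
  direction of translation gives the claim.\<close>

lemma integral_directional_derivative_zero:
  fixes g :: "'a::euclidean_space \<Rightarrow> real"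
  assumes g: "bounded_C1 g G" and S: "bounded S" "\<And>x. x \<notin> S \<Longrightarrow> g x = 0"
  shows "(\<integral>x. G x \<bullet> v \<partial>lborel) = 0"
proof -
  obtain K where K: "K > 0" "\<And>x. \<bar>g x\<bar> \<le> K" "\<And>x. norm (G x) \<le> K"
    using bounded_C1_bound[OF g] by blast
  have gm[measurable]: "g \<in> borel_measurable borel"
    by (intro borel_measurable_continuous_onI bounded_C1_continuous[OF g])
  have Gm[measurable]: "G \<in> borel_measurable borel"
    using g by (intro borel_measurable_continuous_onI) (simp add: bounded_C1_def)
  have gi: "integrable lborel g"
    using integrable_bounded_support[OF gm K(2) S] .
  define q where "q = (\<lambda>i x. real (Suc i) * (g (x + v /\<^sub>R real (Suc i)) - g x))"
  obtain r where r: "S \<subseteq> cball 0 r" using bounded_subset_ballD[OF S(1)] ball_subset_cball by blast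
  define w where "w = (\<lambda>x::'a. indicator (cball 0 (r + norm v)) x * (K * norm v))"
  have "(\<lambda>i. \<integral>x. q i x \<partial>lborel) \<longlonglongrightarrow> (\<integral>x. G x \<bullet> v \<partial>lborel)"
  proof (rule integral_dominated_convergence[where w = w])
    show "(\<lambda>x. G x \<bullet> v) \<in> borel_measurable lborel" by simp
    show "\<And>i. q i \<in> borel_measurable lborel" unfolding q_def by simp
    show "integrable lborel w"
      using emeasure_bounded_finite[of "cball (0::'a) (r + norm v)"] unfolding w_def by simp
    show "AE x in lborel. (\<lambda>i. q i x) \<longlonglongrightarrow> G x \<bullet> v"
    proof (rule AE_I2)
      fix x
      have "((\<lambda>t. x + t *\<^sub>R v) has_derivative (\<lambda>t. t *\<^sub>R v)) (at 0)"
        by (auto intro!: derivative_eq_intros)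
      moreover have "(g has_derivative (\<lambda>h. G x \<bullet> h)) (at (x + 0 *\<^sub>R v))"
        using g by (simp add: bounded_C1_def)
      ultimately have "((\<lambda>t. g (x + t *\<^sub>R v)) has_derivative (\<lambda>t. G x \<bullet> (t *\<^sub>R v))) (at 0)"
        by (rule has_derivative_compose)
      then have "((\<lambda>t. g (x + t *\<^sub>R v)) has_real_derivative (G x \<bullet> v)) (at 0)"
        unfolding has_field_derivative_def by (simp add: mult.commute[of _ "G x \<bullet> v"])
      then have *: "((\<lambda>h. (g (x + h *\<^sub>R v) - g x) / h) \<longlongrightarrow> G x \<bullet> v) (at 0)"
        unfolding DERIV_def by simp
      have f: "filterlim (\<lambda>i. inverse (real (Suc i))) (at 0) sequentially"
        using LIMSEQ_inverse_real_of_nat by (auto simp: filterlim_at)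
      show "(\<lambda>i. q i x) \<longlonglongrightarrow> G x \<bullet> v"
        using filterlim_compose[OF * f] by (simp add: q_def divide_inverse mult.commute)
    qed
    show "AE x in lborel. norm (q i x) \<le> w x" for i
    proof (rule AE_I2)
      fix x
      have le: "norm (v /\<^sub>R real (Suc i)) \<le> norm v"
        by (simp add: field_simps mult_left_le)
      have "\<bar>g (x + v /\<^sub>R real (Suc i)) - g x\<bar> \<le> K * norm (v /\<^sub>R real (Suc i))"
        using bounded_C1_lipschitz[OF g K(3), of "x + v /\<^sub>R real (Suc i)" x] by simp
      then have "real (Suc i) * \<bar>g (x + v /\<^sub>R real (Suc i)) - g x\<bar>
          \<le> real (Suc i) * (K * norm (v /\<^sub>R real (Suc i)))"
        by (intro mult_left_mono) auto
      also have "\<dots> = K * norm v" by (simp del: of_nat_Suc)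
      finally have b: "\<bar>q i x\<bar> \<le> K * norm v"
        by (simp add: q_def abs_mult del: of_nat_Suc)
      show "norm (q i x) \<le> w x"
      proof (cases "norm x \<le> r + norm v")
        case True then show ?thesis using b by (simp add: w_def indicator_def)
      next
        case False
        have "norm x \<le> norm (x + v /\<^sub>R real (Suc i)) + norm (v /\<^sub>R real (Suc i))"
          using norm_triangle_ineq4[of "x + v /\<^sub>R real (Suc i)" "v /\<^sub>R real (Suc i)"] by simp
        with False le have "norm (x + v /\<^sub>R real (Suc i)) > r" by linarith
        moreover have "norm x > r" using False norm_ge_zero[of v] by linarith
        ultimately have "x + v /\<^sub>R real (Suc i) \<notin> S" "x \<notin> S"
          using r by (auto simp: subset_iff)
        then show ?thesis using S(2) K by (simp add: q_def w_def indicator_def)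
      qed
    qed
  qed
  moreover have "(\<integral>x. q i x \<partial>lborel) = 0" for i
  proof -
    have "(\<integral>x. q i x \<partial>lborel) = real (Suc i) * ((\<integral>x. g (x + v /\<^sub>R real (Suc i)) \<partial>lborel) - (\<integral>x. g x \<partial>lborel))"
      unfolding q_def using lborel_integral_translate(2)[OF gm gi] gi by (simp del: of_nat_Suc)
    then show ?thesis by (simp add: lborel_integral_translate(1))
  qed
  ultimately show ?thesis by (simp add: LIMSEQ_const_iff)
qed

text \<open>\<open>T (s * (n \<bullet> x) + u)\<close> differentiated along \<open>n\<close> gives \<open>s * (n \<bullet> n)\<close> times the
  oscillating factor, so integrating by parts along \<open>n\<close> gains the factor \<open>1 / s\<close>, uniformly
  in the phase \<open>u\<close>.\<close>

lemma oscillation_decay: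
  fixes n :: "'a::euclidean_space"
  assumes g: "bounded_C1 g G" and S: "bounded S" "\<And>x. x \<notin> S \<Longrightarrow> g x = 0"
    and T: "\<And>t. (T has_real_derivative \<theta> t) (at t)" "\<And>t. \<bar>T t\<bar> \<le> 1"
    and \<theta>: "continuous_on UNIV \<theta>" "bounded (range \<theta>)"
    and s: "s > 0" and n: "n \<noteq> 0"
    and w: "integrable lborel w" "\<And>x. \<bar>G x \<bullet> n\<bar> \<le> w x"
  shows "\<bar>\<integral>x. g x * \<theta> (s * (n \<bullet> x) + u) \<partial>lborel\<bar> \<le> (\<integral>x. w x \<partial>lborel) / (s * (n \<bullet> n))"
proof -
  define \<psi> where "\<psi> = (\<lambda>x. T (s * (n \<bullet> x) + u))"
  define \<rho> where "\<rho> = (\<lambda>x. g x * \<theta> (s * (n \<bullet> x) + u))"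
  have "bounded (range T)" using T(2) by (auto simp: bounded_iff)
  then have \<psi>: "bounded_C1 \<psi> (\<lambda>x. (s * \<theta> (s * (n \<bullet> x) + u)) *\<^sub>R n)"
    unfolding \<psi>_def by (intro bounded_C1_ridge T \<theta>)
  have \<psi>1: "\<bar>\<psi> x\<bar> \<le> 1" for x by (simp add: \<psi>_def T)
  have [measurable]: "\<theta> \<in> borel_measurable borel" "g \<in> borel_measurable borel"
    "\<psi> \<in> borel_measurable borel" "G \<in> borel_measurable borel"
    using g by (auto intro!: borel_measurable_continuous_onI \<theta> bounded_C1_continuous[OF g]
        bounded_C1_continuous[OF \<psi>] simp: bounded_C1_def)
  obtain Kg where Kg: "\<And>x. \<bar>g x\<bar> \<le> Kg" using bounded_C1_bound[OF g] by metis
  obtain K\<theta> where K\<theta>: "\<And>t. \<bar>\<theta> t\<bar> \<le> K\<theta>" using \<theta>(2) by (auto simp: bounded_iff)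
  have \<rho>i: "integrable lborel \<rho>"
  proof (rule integrable_bounded_support[where K = "Kg * K\<theta>" and S = S])
    show "\<bar>\<rho> x\<bar> \<le> Kg * K\<theta>" for x
      unfolding \<rho>_def abs_mult by (intro mult_mono Kg K\<theta>) (use Kg[of x] in auto)
  qed (use S in \<open>auto simp: \<rho>_def\<close>)
  have gi: "integrable lborel (\<lambda>x. \<psi> x * (G x \<bullet> n))"
  proof (rule Bochner_Integration.integrable_bound[OF w(1)])
    show "AE x in lborel. norm (\<psi> x * (G x \<bullet> n)) \<le> norm (w x)"
    proof (rule AE_I2)
      fix x
      have "\<bar>\<psi> x\<bar> * \<bar>G x \<bullet> n\<bar> \<le> 1 * w x"
        by (intro mult_mono \<psi>1 w) auto
      then show "norm (\<psi> x * (G x \<bullet> n)) \<le> norm (w x)" by (simp add: abs_mult)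
    qed
  qed simp
  have "(\<integral>x. (g x *\<^sub>R ((s * \<theta> (s * (n \<bullet> x) + u)) *\<^sub>R n) + \<psi> x *\<^sub>R G x) \<bullet> n \<partial>lborel) = 0"
    by (rule integral_directional_derivative_zero[OF bounded_C1_mult[OF g \<psi>] S(1)]) (simp add: S)
  moreover have "(\<lambda>x. (g x *\<^sub>R ((s * \<theta> (s * (n \<bullet> x) + u)) *\<^sub>R n) + \<psi> x *\<^sub>R G x) \<bullet> n)
      = (\<lambda>x. (s * (n \<bullet> n)) * \<rho> x + \<psi> x * (G x \<bullet> n))"
    by (simp add: fun_eq_iff inner_simps \<rho>_def)
  ultimately have *: "(s * (n \<bullet> n)) * (\<integral>x. \<rho> x \<partial>lborel) = - (\<integral>x. \<psi> x * (G x \<bullet> n) \<partial>lborel)"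
    using \<rho>i gi by simp
  have "\<bar>\<integral>x. \<psi> x * (G x \<bullet> n) \<partial>lborel\<bar> \<le> (\<integral>x. w x \<partial>lborel)"
  proof -
    have "norm (\<integral>x. \<psi> x * (G x \<bullet> n) \<partial>lborel) \<le> (\<integral>x. w x \<partial>lborel)"
    proof (rule Bochner_Integration.integral_norm_bound_integral[OF gi w(1)])
      fix x
      have "\<bar>\<psi> x\<bar> * \<bar>G x \<bullet> n\<bar> \<le> 1 * w x"
        by (intro mult_mono \<psi>1 w) auto
      then show "norm (\<psi> x * (G x \<bullet> n)) \<le> w x" by (simp add: abs_mult)
    qed
    then show ?thesis by simp
  qed
  moreover have "s * (n \<bullet> n) > 0" using s n by simp
  moreover have "\<bar>(s * (n \<bullet> n)) * (\<integral>x. \<rho> x \<partial>lborel)\<bar> = s * (n \<bullet> n) * \<bar>\<integral>x. \<rho> x \<partial>lborel\<bar>"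
    using s by (simp add: abs_mult)
  ultimately show ?thesis unfolding \<rho>_def[symmetric] using *
    by (simp add: pos_le_divide_eq mult.commute)
qed

section \<open>Choosing the phase of an oscillation\<close>

text \<open>By Fubini's theorem, the average over the phases \<open>u \<in> [0, 1]\<close> of the left-hand side is the
  right-hand side. This replaces the usual limit of fast oscillation: the bound holds for every
  frequency, and the frequency stays free for making the divergence small.\<close>

lemma (in sigma_finite_measure) exists_phase_below_mean:
  fixes h :: "real \<Rightarrow> real"
  assumes w: "integrable M w" "\<And>x. 0 \<le> w x" and a[measurable]: "a \<in> borel_measurable M"
    and h: "continuous_on UNIV h" "\<And>t. 0 \<le> h t" "\<And>t. h t \<le> H"
    and m: "\<And>s. integral {0..1} (\<lambda>t. h (s + t)) = m"
  shows "\<exists>u. (\<integral>x. w x * h (a x + u) \<partial>M) \<le> m * (\<integral>x. w x \<partial>M)"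
proof (rule ccontr)
  define I where "I = (\<lambda>u. \<integral>x. w x * h (a x + u) \<partial>M)"
  assume "\<not> ?thesis"
  then have less: "m * (\<integral>x. w x \<partial>M) < I u" for u unfolding I_def by (meson not_le)
  define N :: "real measure" where "N = restrict_space lborel {0..1}"
  have setsN: "sets N = sets (restrict_space borel {0..1})"
    by (simp add: N_def sets_restrict_space)
  have spN: "space N = {0..1}" by (simp add: N_def space_restrict_space)
  have emN: "emeasure N (space N) = 1"
    by (simp add: N_def emeasure_restrict_space space_restrict_space)
  interpret N: finite_measure N
    using emN by (intro finite_measureI) simp
  have N1: "measure N (space N) = 1" using emN by (simp add: measure_def)
  interpret P: pair_sigma_finite N M ..
  have id[measurable]: "(\<lambda>x. x) \<in> borel_measurable N"
    unfolding N_def by (rule measurable_restrict_space1) simp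
  have hm[measurable]: "h \<in> borel_measurable borel"
    by (intro borel_measurable_continuous_onI h)
  have wm[measurable]: "w \<in> borel_measurable M" using w by auto
  have H0: "0 \<le> H" using h(2,3) order_trans by blast
  have meas: "(\<lambda>(u, x). w x * h (a x + u)) \<in> borel_measurable (N \<Otimes>\<^sub>M M)"
  proof -
    have "fst \<in> borel_measurable (N \<Otimes>\<^sub>M M)"
      using measurable_compose[OF measurable_fst id] by simp
    then show ?thesis unfolding case_prod_beta by measurable
  qed
  have wH: "integrable M (\<lambda>x. w x * H)" using w(1) by simp
  have int_x: "integrable M (\<lambda>x. w x * h (a x + u))" for u
    by (rule Bochner_Integration.integrable_bound[OF wH])
       (use w h H0 in \<open>auto intro!: mult_left_mono simp: abs_mult\<close>)
  have intN: "(\<integral>u. h (s + u) \<partial>N) = m" for s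
  proof -
    have c: "continuous_on {0..1} (\<lambda>u. h (s + u))"
      by (intro continuous_on_compose2[OF h(1)] continuous_intros) auto
    have "(\<integral>u. h (s + u) \<partial>N) = set_lebesgue_integral lborel {0..1} (\<lambda>u. h (s + u))"
      unfolding N_def set_lebesgue_integral_def
      by (subst integral_restrict_space) (auto)
    also have "\<dots> = integral {0..1} (\<lambda>u. h (s + u))"
      by (intro set_borel_integral_eq_integral borel_integrable_atLeastAtMost')
         (rule c)
    finally show ?thesis by (simp add: m)
  qed
  have int: "integrable (N \<Otimes>\<^sub>M M) (\<lambda>(u, x). w x * h (a x + u))"
  proof (rule P.Fubini_integrable[OF meas])
    have "integrable N I"
    proof (rule N.integrable_const_bound)
      show "AE u in N. norm (I u) \<le> H * (\<integral>x. w x \<partial>M)"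
      proof (rule AE_I2)
        fix u
        have "norm (I u) \<le> (\<integral>x. w x * H \<partial>M)"
          unfolding I_def
          by (rule order_trans[OF integral_norm_bound integral_mono[OF integrable_norm[OF int_x] wH]])
             (use w h in \<open>auto intro!: mult_left_mono simp: abs_mult\<close>)
        then show "norm (I u) \<le> H * (\<integral>x. w x \<partial>M)" by (simp add: mult.commute)
      qed
      show "I \<in> borel_measurable N"
        unfolding I_def using meas by (rule borel_measurable_lebesgue_integral)
    qed
    moreover have "I = (\<lambda>u. \<integral>x. norm (case (u, x) of (u, x) \<Rightarrow> w x * h (a x + u)) \<partial>M)"
      using w h by (simp add: I_def abs_mult)
    ultimately show "integrable N (\<lambda>u. \<integral>x. norm (case (u, x) of (u, x) \<Rightarrow> w x * h (a x + u)) \<partial>M)"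
      by simp
    show "AE u in N. integrable M (\<lambda>x. case (u, x) of (u, x) \<Rightarrow> w x * h (a x + u))"
      using int_x by simp
  qed
  have iI: "integrable N I"
    using P.integrable_fst[OF int] by (simp add: I_def)
  have "(\<integral>u. I u \<partial>N) = (\<integral>x. (\<integral>u. w x * h (a x + u) \<partial>N) \<partial>M)"
    using P.Fubini_integral[OF int] by (simp add: I_def)
  also have "\<dots> = m * (\<integral>x. w x \<partial>M)"
    by (simp add: intN)
  finally have "(\<integral>u. I u - m * (\<integral>x. w x \<partial>M) \<partial>N) = 0"
    using iI N1 by simp
  moreover have "AE u in N. 0 \<le> I u - m * (\<integral>x. w x \<partial>M)"
    using less by (auto intro!: AE_I2 less_imp_le)
  ultimately have "AE u in N. I u - m * (\<integral>x. w x \<partial>M) = 0"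
    by (subst (asm) integral_nonneg_eq_0_iff_AE) (use iI in auto)
  then have "AE u in N. False"
  proof (rule AE_mp, intro AE_I2 impI)
    fix u assume "I u - m * (\<integral>x. w x \<partial>M) = 0"
    then show False using less[of u] by simp
  qed
  then show False using emN ae_filter_eq_bot_iff[of N] by (simp add: eventually_False)
qed

section \<open>Periodic switching profiles\<close>

lemma periodic_bounded_range:
  fixes f :: "real \<Rightarrow> real"
  assumes "continuous_on UNIV f" and per: "\<And>t. f (t + 1) = f t"
  shows "bounded (range f)"
proof -
  interpret periodic_fun_simple' f by unfold_locales (rule per)
  have "f t \<in> f ` {0..1}" for t
  proof -
    have "f t = f (frac t + of_int \<lfloor>t\<rfloor>)" by (simp add: frac_def)
    also have "\<dots> = f (frac t)" by (rule plus_of_int)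
    finally show ?thesis using frac_ge_0[of t] frac_lt_1[of t] by auto
  qed
  then have "range f \<subseteq> f ` {0..1}" by auto
  moreover have "compact (f ` {0..1})"
    using assms(1) by (intro compact_continuous_image) (auto intro: continuous_on_subset)
  ultimately show ?thesis using bounded_subset compact_imp_bounded by blast
qed

lemma integral_shift_derivative:
  fixes k h h' :: "real \<Rightarrow> real"
  assumes k: "continuous_on UNIV k"
    and h: "\<And>t. (h has_real_derivative h' t) (at t)" and h': "continuous_on UNIV h'"
  shows "((\<lambda>s. integral {0..1} (\<lambda>t. k t * h (s + t))) has_real_derivative
           integral {0..1} (\<lambda>t. k t * h' (s + t))) (at s)"
proof -
  have hc: "continuous_on UNIV h"
    using h by (meson DERIV_isCont continuous_at_imp_continuous_on)
  have "((\<lambda>s. integral (cbox 0 1) (\<lambda>t. k t * h (s + t))) has_real_derivative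
           integral (cbox 0 1) (\<lambda>t. k t * h' (s + t))) (at s within UNIV)"
  proof (rule leibniz_rule_field_derivative)
    fix x t :: real
    show "((\<lambda>x. k t * h (x + t)) has_real_derivative k t * h' (x + t)) (at x within UNIV)"
      using DERIV_shift[of h "h' (x + t)" x t] h by (auto intro!: derivative_eq_intros)
    show "(\<lambda>t. k t * h (x + t)) integrable_on cbox 0 1"
      by (intro integrable_continuous continuous_intros continuous_on_compose2[OF k]
           continuous_on_compose2[OF hc]) auto
    show "continuous_on (UNIV \<times> cbox 0 1) (\<lambda>(x, t). k t * h' (x + t))"
      unfolding case_prod_beta
      by (intro continuous_intros continuous_on_compose2[OF k]
           continuous_on_compose2[OF h']) auto
  qed auto
  then show ?thesis by (simp add: cbox_interval)
qed

lemma periodic_integral_shift: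
  fixes h :: "real \<Rightarrow> real"
  assumes h: "\<And>t. (h has_real_derivative h' t) (at t)" and h': "continuous_on UNIV h'"
    and per: "\<And>t. h (t + 1) = h t"
  shows "integral {0..1} (\<lambda>t. h (s + t)) = integral {0..1} h"
proof -
  have "((\<lambda>s. integral {0..1} (\<lambda>t. h (s + t))) has_real_derivative 0) (at s)" for s
  proof -
    have "((\<lambda>t. h' (s + t)) has_integral h (s + 1) - h (s + 0)) {0..1}"
    proof (intro fundamental_theorem_of_calculus)
      fix t :: real
      have "((\<lambda>t. h (s + t)) has_real_derivative h' (s + t)) (at t)"
        using DERIV_shift[of h "h' (s + t)" t s] h by (simp add: add.commute)
      then show "((\<lambda>t. h (s + t)) has_vector_derivative h' (s + t)) (at t within {0..1})"
        by (simp add: has_real_derivative_iff_has_vector_derivative has_vector_derivative_at_within)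
    qed simp
    then have "integral {0..1} (\<lambda>t. h' (s + t)) = 0" by (simp add: per integral_unique)
    then show ?thesis using integral_shift_derivative[OF continuous_on_const[of _ 1] h h', of s] by simp
  qed
  from DERIV_isconst_all[of "\<lambda>s. integral {0..1} (\<lambda>t. h (s + t))" s 0] this
  show ?thesis by simp
qed

text \<open>The antiderivative is \<open>T s = \<integral> t h(s + t) dt\<close> over \<open>[0, 1]\<close>: integrating its derivative
  \<open>\<integral> t h'(s + t) dt\<close> by parts gives \<open>h s\<close> minus the mean, and \<open>\<bar>T\<bar> \<le> 1\<close> because \<open>0 \<le> h \<le> 1\<close>.\<close>

lemma periodic_antiderivative:
  fixes h :: "real \<Rightarrow> real"
  assumes h: "\<And>t. (h has_real_derivative h' t) (at t)" and h': "continuous_on UNIV h'"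
    and per: "\<And>t. h (t + 1) = h t" and bound: "\<And>t. 0 \<le> h t" "\<And>t. h t \<le> 1"
  shows "\<exists>T. (\<forall>t. (T has_real_derivative h t - integral {0..1} h) (at t)) \<and> (\<forall>t. \<bar>T t\<bar> \<le> 1)"
proof -
  define T where "T = (\<lambda>s. integral {0..1} (\<lambda>t. t * h (s + t)))"
  have hc: "continuous_on A h" for A
    using h by (meson DERIV_isCont continuous_at_imp_continuous_on)
  have int: "(\<lambda>t. t * h (s + t)) integrable_on {0..1}" "(\<lambda>t. h (s + t)) integrable_on {0..1}" 
    for s
    by (intro integrable_continuous_real continuous_intros continuous_on_compose2[OF hc[of UNIV]]; simp)+
  have "(T has_real_derivative h s - integral {0..1} h) (at s)" for s
  proof -
    have "((\<lambda>t. h (s + t) + t * h' (s + t)) has_integral 1 * h (s + 1) - 0 * h (s + 0)) {0..1}"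
    proof (intro fundamental_theorem_of_calculus)
      fix t :: real
      have "((\<lambda>t. h (s + t)) has_real_derivative h' (s + t)) (at t)"
        using DERIV_shift[of h "h' (s + t)" t s] h by (simp add: add.commute)
      then have "((\<lambda>t. t * h (s + t)) has_real_derivative h (s + t) + t * h' (s + t)) (at t)"
        by (auto intro!: derivative_eq_intros)
      then show "((\<lambda>t. t * h (s + t)) has_vector_derivative h (s + t) + t * h' (s + t)) (at t within {0..1})"
        by (simp add: has_real_derivative_iff_has_vector_derivative has_vector_derivative_at_within)
    qed simp
    then have "integral {0..1} (\<lambda>t. h (s + t) + t * h' (s + t)) = h s"
      by (simp add: integral_unique per)
    moreover have "(\<lambda>t. t * h' (s + t)) integrable_on {0..1}"
      by (intro integrable_continuous_real continuous_intros continuous_on_compose2[OF h']) auto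
    ultimately have "integral {0..1} (\<lambda>t. t * h' (s + t)) = h s - integral {0..1} h"
      using periodic_integral_shift[OF h h' per, of s] int(2)
      by (simp add: Henstock_Kurzweil_Integration.integral_add)
    then show ?thesis
      unfolding T_def using integral_shift_derivative[OF continuous_on_id h h', of s] by simp
  qed
  moreover have "\<bar>T s\<bar> \<le> 1" for s
  proof -
    have "norm (integral {0..1} (\<lambda>t. t * h (s + t))) \<le> integral {0..1} (\<lambda>t::real. 1)"
      by (rule Henstock_Kurzweil_Integration.integral_norm_bound_integral[OF int(1)])
         (use bound in \<open>auto simp: abs_mult intro!: mult_le_one\<close>)
    then show ?thesis by (simp add: T_def)
  qed
  ultimately show ?thesis by blast
qed

text \<open>The logistic function composed with \<open>k g\<close> tends to the indicator function of \<open>{g > 0}\<close>, except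
  at the zeros of \<open>g\<close>; dominated convergence gives both limits.\<close>

lemma logistic_profile_limits:
  fixes g :: "real \<Rightarrow> real"
  assumes a: "0 < a" "a < 1" and g: "continuous_on UNIV g"
    and pos: "\<And>t. 0 < t \<Longrightarrow> t < a \<Longrightarrow> 0 < g t" and neg: "\<And>t. a < t \<Longrightarrow> t < 1 \<Longrightarrow> g t < 0"
    and zero: "g 0 = 0" "g a = 0" "g 1 = 0"
  defines "c \<equiv> \<lambda>k t. 1 / (1 + exp (- (real k * g t)))"
  shows "(\<lambda>k. integral {0..1} (c k)) \<longlonglongrightarrow> a"
    and "(\<lambda>k. integral {0..1} (\<lambda>t. c k t * (1 - c k t))) \<longlonglongrightarrow> 0"
proof -
  define l where "l = (\<lambda>t. if 0 < t \<and> t < a then 1 else if a < t \<and> t < 1 then 0 else 1 / 2 :: real)"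
  have bnd: "0 \<le> c k t" "c k t \<le> 1" for k t
    by (auto simp: c_def add_pos_pos divide_le_eq_1)
  have cont: "continuous_on {0..1} (c k)" for k
    unfolding c_def
    by (intro continuous_intros continuous_on_subset[OF g]) (auto simp: add_pos_pos less_imp_neq[symmetric])
  have lim: "(\<lambda>k. c k t) \<longlonglongrightarrow> l t" if t: "t \<in> {0..1}" for t
  proof -
    consider "0 < t" "t < a" | "a < t" "t < 1" | "t \<in> {0, a, 1}" using t by force
    then show ?thesis
    proof cases
      case 1
      then have "g t > 0" by (rule pos)
      then have "(\<lambda>k. c k t) \<longlonglongrightarrow> 1" unfolding c_def by real_asymp
      then show ?thesis using 1 by (simp add: l_def)
    next
      case 2
      then have "g t < 0" by (rule neg)
      then have "(\<lambda>k. c k t) \<longlonglongrightarrow> 0" unfolding c_def by real_asymp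
      then show ?thesis using 2 a by (simp add: l_def)
    next
      case 3
      then have "(\<lambda>k. c k t) = (\<lambda>_. l t)" using zero a by (auto simp: c_def l_def fun_eq_iff)
      then show ?thesis by simp
    qed
  qed
  have "(l has_integral a + 0) {0..1}"
  proof (rule has_integral_combine[where c = a])
    have "((\<lambda>_. 1::real) has_integral a) {0..a}"
      using has_integral_const_real[of "1::real" 0 a] a by simp
    then show "(l has_integral a) {0..a}"
      by (rule has_integral_spike_finite[rotated 2, where S = "{0, a}"]) (use a in \<open>auto simp: l_def\<close>)
    have "((\<lambda>_. 0::real) has_integral 0) {a..1}" by simp
    then show "(l has_integral 0) {a..1}"
      by (rule has_integral_spike_finite[rotated 2, where S = "{a, 1}"]) (use a in \<open>auto simp: l_def\<close>)
  qed (use a in auto)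
  then have il: "integral {0..1} l = a" by (simp add: integral_unique)
  have "(\<lambda>k. integral {0..1} (c k)) \<longlonglongrightarrow> integral {0..1} l"
    by (rule dominated_convergence(2)[where h = "\<lambda>_. 1"])
       (use bnd cont lim in \<open>auto intro!: integrable_continuous_real\<close>)
  then show "(\<lambda>k. integral {0..1} (c k)) \<longlonglongrightarrow> a" by (simp add: il)
  have "((\<lambda>t. l t * (1 - l t)) has_integral 0) {0..1}"
    by (rule has_integral_spike_finite[where S = "{0, a, 1}" and f = "\<lambda>_. 0"]) (auto simp: l_def)
  then have ill: "integral {0..1} (\<lambda>t. l t * (1 - l t)) = 0" by (simp add: integral_unique)
  have "(\<lambda>k. integral {0..1} (\<lambda>t. c k t * (1 - c k t))) \<longlonglongrightarrow> integral {0..1} (\<lambda>t. l t * (1 - l t))"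
    by (rule dominated_convergence(2)[where h = "\<lambda>_. 1"])
       (use bnd cont lim in \<open>auto intro!: integrable_continuous_real continuous_intros tendsto_intros
           mult_le_one simp: abs_mult\<close>)
  then show "(\<lambda>k. integral {0..1} (\<lambda>t. c k t * (1 - c k t))) \<longlonglongrightarrow> 0" by (simp add: ill)
qed

text \<open>A smooth substitute for the 1-periodic extension of the indicator function of \<open>[0, a]\<close>. Up
  to \<open>\<delta>\<close> its mean is \<open>a\<close>, and it is close to \<open>0\<close> or \<open>1\<close> in the sense that \<open>c (1 - c)\<close> has mean at
  most \<open>\<delta>\<close>. Periodicity is expressed by means that do not depend on the shift \<open>s\<close>. The bounded
  antiderivative \<open>T\<close> of \<open>c - m\<close> is what the estimates for oscillating factors use.\<close>

definition switching_profile :: "real \<Rightarrow> real \<Rightarrow> (real \<Rightarrow> real) \<Rightarrow> bool" where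
  "switching_profile a \<delta> c \<longleftrightarrow>
     (\<forall>t. 0 \<le> c t \<and> c t \<le> 1) \<and>
     (\<exists>c' c''. (\<forall>t. (c has_real_derivative c' t) (at t)) \<and> (\<forall>t. (c' has_real_derivative c'' t) (at t)) \<and>
        bounded (range c') \<and> bounded (range c'') \<and> continuous_on UNIV c'') \<and>
     (\<exists>m T. \<bar>m - a\<bar> \<le> \<delta> \<and> (\<forall>s. integral {0..1} (\<lambda>t. c (s + t)) = m) \<and>
        (\<forall>t. (T has_real_derivative c t - m) (at t)) \<and> (\<forall>t. \<bar>T t\<bar> \<le> 1)) \<and>
     (\<exists>d\<le>\<delta>. \<forall>s. integral {0..1} (\<lambda>t. c (s + t) * (1 - c (s + t))) = d)"

text \<open>The function \<open>g t = 2 sin(\<pi> t) sin(\<pi> (a - t))\<close> has period 1, is positive on \<open>]0, a[\<close> and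
  negative on \<open>]a, 1[\<close>, so a steep logistic function of it is a switching profile.\<close>

lemma switching_profile_exists:
  assumes a: "0 < a" "a < 1" and \<delta>: "\<delta> > 0"
  shows "\<exists>c. switching_profile a \<delta> c"
proof -
  \<comment> \<open>Written as a difference of cosines, the product of sines has simple derivatives.\<close>
  define g where "g = (\<lambda>t. cos (2 * pi * t - pi * a) - cos (pi * a))"
  define g' where "g' = (\<lambda>t. - 2 * pi * sin (2 * pi * t - pi * a))"
  define g'' where "g'' = (\<lambda>t. - 4 * pi^2 * cos (2 * pi * t - pi * a))"
  have dg: "(g has_real_derivative g' t) (at t)" "(g' has_real_derivative g'' t) (at t)" for t
    unfolding g_def g'_def g''_def by (auto intro!: derivative_eq_intros simp: power2_eq_square)
  have gcont: "continuous_on UNIV g" "continuous_on UNIV g'" "continuous_on UNIV g''"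
    unfolding g_def g'_def g''_def by (auto intro!: continuous_intros)
  have gform: "g t = 2 * sin (pi * t) * sin (pi * (a - t))" for t
  proof -
    have "g t = 2 * sin ((2 * pi * t - pi * a + pi * a) / 2) * sin ((pi * a - (2 * pi * t - pi * a)) / 2)"
      unfolding g_def by (rule cos_diff_cos)
    moreover have "(2 * pi * t - pi * a + pi * a) / 2 = pi * t"
      "(pi * a - (2 * pi * t - pi * a)) / 2 = pi * (a - t)" by (auto simp: field_simps)
    ultimately show ?thesis by simp
  qed
  have sin_pos: "0 < sin (pi * t)" if "0 < t" "t < 1" for t
    using that by (intro sin_gt_zero) auto
  have pos: "0 < g t" if "0 < t" "t < a" for t
    unfolding gform using sin_pos[of t] sin_pos[of "a - t"] that a by simp
  have neg: "g t < 0" if "a < t" "t < 1" for t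
  proof -
    have "sin (pi * (a - t)) = - sin (pi * (t - a))"
      by (metis minus_diff_eq mult_minus_right sin_minus)
    then show ?thesis
      unfolding gform using sin_pos[of t] sin_pos[of "t - a"] that a by simp
  qed
  have zero: "g 0 = 0" "g a = 0" "g 1 = 0" by (simp_all add: gform)
  define c where "c = (\<lambda>(k::nat) t. 1 / (1 + exp (- (real k * g t))))"
  note lims = logistic_profile_limits[OF a gcont(1) pos neg zero]
  obtain k where k: "\<bar>integral {0..1} (c k) - a\<bar> < \<delta>"
    "\<bar>integral {0..1} (\<lambda>t. c k t * (1 - c k t))\<bar> < \<delta>"
  proof -
    have "\<forall>\<^sub>F k in sequentially. \<bar>integral {0..1} (c k) - a\<bar> < \<delta>"
      using tendstoD[OF lims(1) \<delta>] by (simp add: dist_real_def c_def)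
    moreover have "\<forall>\<^sub>F k in sequentially. \<bar>integral {0..1} (\<lambda>t. c k t * (1 - c k t))\<bar> < \<delta>"
      using tendstoD[OF lims(2) \<delta>] by (simp add: dist_real_def c_def)
    ultimately show ?thesis
      using that eventually_happens'[OF sequentially_bot eventually_conj] by blast
  qed
  define f where "f = c k"
  define f' where "f' = (\<lambda>t. real k * g' t * (f t * (1 - f t)))"
  define f'' where "f'' = (\<lambda>t. real k * g'' t * (f t * (1 - f t)) + real k * g' t * (f' t * (1 - 2 * f t)))"
  have ne: "1 + exp (x::real) \<noteq> 0" for x by (metis add_pos_pos exp_gt_zero less_irrefl zero_less_one)
  have bnd: "0 \<le> f t" "f t \<le> 1" for t
    by (auto simp: f_def c_def add_pos_pos divide_le_eq_1)
  have d1: "(f has_real_derivative f' t) (at t)" for t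
    unfolding f_def f'_def c_def
    by (rule derivative_eq_intros dg(1) refl ne)+ (use ne in \<open>auto simp: field_simps power2_eq_square\<close>)
  have d2: "(f' has_real_derivative f'' t) (at t)" for t
    unfolding f'_def f''_def
    by (rule derivative_eq_intros dg d1 refl)+ (auto simp: f'_def algebra_simps)
  have cont: "continuous_on UNIV f" "continuous_on UNIV f'"
    using d1 d2 by (meson DERIV_isCont continuous_at_imp_continuous_on)+
  have cont'': "continuous_on UNIV f''"
    unfolding f''_def by (intro continuous_intros cont gcont)
  have shift: "2 * pi * (t + 1) - pi * a = (2 * pi * t - pi * a) + 2 * pi" for t by (simp add: algebra_simps)
  have gper: "g (t + 1) = g t" "g' (t + 1) = g' t" "g'' (t + 1) = g'' t" for t
    unfolding g_def g'_def g''_def shift by simp_all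
  have per: "f (t + 1) = f t" for t by (simp add: f_def c_def gper)
  have per': "f' (t + 1) = f' t" for t by (simp add: f'_def per gper)
  have per'': "f'' (t + 1) = f'' t" for t by (simp add: f''_def per per' gper)
  have b: "bounded (range f')" "bounded (range f'')"
    using periodic_bounded_range cont cont'' per' per'' by blast+
  obtain T where T: "\<And>t. (T has_real_derivative f t - integral {0..1} f) (at t)" "\<And>t. \<bar>T t\<bar> \<le> 1"
    using periodic_antiderivative[OF d1 cont(2) per bnd] by blast
  have m: "integral {0..1} (\<lambda>t. f (s + t)) = integral {0..1} f" for s
    by (rule periodic_integral_shift[OF d1 cont(2) per])
  have "integral {0..1} (\<lambda>t. f (s + t) * (1 - f (s + t))) = integral {0..1} (\<lambda>t. f t * (1 - f t))" for s
  proof (rule periodic_integral_shift)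
    show "((\<lambda>t. f t * (1 - f t)) has_real_derivative f' t * (1 - f t) + f t * (- f' t)) (at t)" for t
      by (auto intro!: derivative_eq_intros d1)
    show "continuous_on UNIV (\<lambda>t. f' t * (1 - f t) + f t * (- f' t))"
      by (intro continuous_intros cont)
  qed (simp add: per)
  moreover have "integral {0..1} (\<lambda>t. f t * (1 - f t)) \<le> \<delta>"
    using k(2) by (simp add: f_def)
  ultimately have 1: "\<exists>d\<le>\<delta>. \<forall>s. integral {0..1} (\<lambda>t. f (s + t) * (1 - f (s + t))) = d" by blast
  have "\<bar>integral {0..1} f - a\<bar> \<le> \<delta>" using k(1) by (simp add: f_def)
  with m T have 2: "\<exists>m T. \<bar>m - a\<bar> \<le> \<delta> \<and> (\<forall>s. integral {0..1} (\<lambda>t. f (s + t)) = m) \<and>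
      (\<forall>t. (T has_real_derivative f t - m) (at t)) \<and> (\<forall>t. \<bar>T t\<bar> \<le> 1)" by blast
  have 3: "\<exists>f' f''. (\<forall>t. (f has_real_derivative f' t) (at t)) \<and> (\<forall>t. (f' has_real_derivative f'' t) (at t)) \<and>
      bounded (range f') \<and> bounded (range f'') \<and> continuous_on UNIV f''"
    using d1 d2 b cont'' by blast
  have "switching_profile a \<delta> f"
    unfolding switching_profile_def by (intro conjI 1 2 3) (use bnd in auto)
  then show ?thesis by blast
qed

section \<open>Test functions and the divergence\<close>

lemma gradient_zero_outside_support:
  assumes g: "\<And>x. (g has_derivative (\<lambda>h. G x \<bullet> h)) (at x)"
    and S: "\<And>x. x \<notin> S \<Longrightarrow> g x = 0" and x: "x \<notin> closure S"
  shows "G x = 0"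
proof -
  have "(g has_derivative (\<lambda>h. 0)) (at x)"
  proof (rule has_derivative_transform_within_open[of "\<lambda>_. 0"])
    show "open (- closure S)" by auto
    show "x \<in> - closure S" using x by simp
    show "0 = g y" if "y \<in> - closure S" for y
      using that S[of y] closure_subset[of S] by auto
  qed simp
  then have "(\<lambda>h. G x \<bullet> h) = (\<lambda>h. 0)"
    using g has_derivative_unique by blast
  then have "G x \<bullet> G x = 0" by metis
  then show ?thesis by simp
qed

lemma bounded_range_compact_support:
  fixes f :: "'a::euclidean_space \<Rightarrow> 'b::real_normed_vector"
  assumes "continuous_on UNIV f" "bounded S" "\<And>x. x \<notin> closure S \<Longrightarrow> f x = 0"
  shows "bounded (range f)"
proof -
  have "compact (f ` closure S)"
    using assms by (intro compact_continuous_image) (auto intro: continuous_on_subset)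
  moreover have "range f \<subseteq> insert 0 (f ` closure S)"
    using assms(3) by auto
  ultimately show ?thesis
    by (meson bounded_insert bounded_subset compact_imp_bounded)
qed

lemma integrable_continuous_bounded_support:
  fixes h :: "'a::euclidean_space \<Rightarrow> 'b::{banach, second_countable_topology}"
  assumes h: "continuous_on UNIV h" and S: "bounded S" "\<And>x. x \<notin> S \<Longrightarrow> h x = 0"
  shows "integrable lborel h"
proof -
  have "h x = 0" if "x \<notin> closure S" for x using that closure_subset[of S] S(2) by blast
  then obtain k where "\<And>x. norm (h x) \<le> k"
    using bounded_range_compact_support[OF h S(1)] by (auto simp: bounded_iff)
  then have "integrable lborel (\<lambda>x. norm (h x))"
    by (intro integrable_bounded_support[OF _ _ S(1)] borel_measurable_continuous_onI continuous_intros h)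
       (auto simp: S)
  then show ?thesis
    by (rule integrable_norm_cancel) (use borel_measurable_continuous_onI[OF h] in simp)
qed

lemma bounded_C1_compact_support:
  assumes g: "\<And>x. (g has_derivative (\<lambda>h. G x \<bullet> h)) (at x)" and G: "continuous_on UNIV G"
    and S: "bounded S" "\<And>x. x \<notin> S \<Longrightarrow> g x = 0"
  shows "bounded_C1 g G"
proof -
  have "continuous_on UNIV g"
    using g by (meson continuous_at_imp_continuous_on has_derivative_continuous)
  then have "bounded (range g)"
    by (rule bounded_range_compact_support[OF _ S(1)]) (use S(2) closure_subset in blast)
  moreover have "bounded (range G)"
    by (rule bounded_range_compact_support[OF G S(1)]) (rule gradient_zero_outside_support[OF g S(2)])
  ultimately show ?thesis using g G by (simp add: bounded_C1_def)
qed

lemma integral_lebesgue_on_eq_lborel: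
  fixes u :: "'a::euclidean_space \<Rightarrow> real"
  assumes [measurable]: "u \<in> borel_measurable borel" "\<Omega> \<in> sets borel"
    and 0: "\<And>x. x \<notin> \<Omega> \<Longrightarrow> u x = 0"
  shows "integral\<^sup>L (lebesgue_on \<Omega>) u = (\<integral>x. u x \<partial>lborel)"
proof -
  have "integral\<^sup>L (lebesgue_on \<Omega>) u = (\<integral>x. indicator \<Omega> x *\<^sub>R u x \<partial>lebesgue)"
    by (rule integral_restrict_space) simp
  also have "(\<lambda>x. indicator \<Omega> x *\<^sub>R u x) = u"
    using 0 by (auto simp: indicator_def fun_eq_iff)
  also have "integral\<^sup>L lebesgue u = (\<integral>x. u x \<partial>lborel)"
    by (rule integral_completion) simp
  finally show ?thesis .
qed

context
  fixes \<Omega> :: "(real^3) set" and \<phi> :: "real^3 \<Rightarrow> real"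
  assumes \<Omega>: "open \<Omega>" and \<phi>: "\<phi> \<in> test_functions \<Omega>"
begin

lemma test_function_support:
  shows "bounded {x. \<phi> x \<noteq> 0}" "x \<notin> \<Omega> \<Longrightarrow> x \<notin> closure {x. \<phi> x \<noteq> 0}"
  using \<phi> unfolding test_functions_def
  by (auto dest: compact_imp_bounded intro: bounded_subset[OF _ closure_subset])

lemma test_function_gradient:
  shows "(\<phi> has_derivative (\<lambda>h. grad \<phi> x \<bullet> h)) (at x)" and "continuous_on UNIV (grad \<phi>)"
proof -
  have sm: "foldr partial_deriv js \<phi> differentiable_on UNIV" for js
    using \<phi> by (simp add: test_functions_def smooth_def)
  from sm[of "[]"] have "\<phi> differentiable (at x)" by (simp add: differentiable_on_def)
  then have d: "(\<phi> has_derivative frechet_derivative \<phi> (at x)) (at x)"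
    by (simp add: frechet_derivative_works)
  then interpret L: bounded_linear "frechet_derivative \<phi> (at x)"
    by (rule has_derivative_bounded_linear)
  have "frechet_derivative \<phi> (at x) h = grad \<phi> x \<bullet> h" for h
  proof -
    have "frechet_derivative \<phi> (at x) h = frechet_derivative \<phi> (at x) (\<Sum>j\<in>UNIV. h $ j *\<^sub>R axis j 1)"
      by (metis (no_types, lifting) basis_expansion scalar_mult_eq_scaleR sum.cong)
    also have "\<dots> = grad \<phi> x \<bullet> h"
      by (simp add: L.sum L.scaleR inner_vec_def grad_def partial_deriv_def mult.commute)
    finally show ?thesis .
  qed
  then have "frechet_derivative \<phi> (at x) = (\<lambda>h. grad \<phi> x \<bullet> h)" by (rule ext)
  then show "(\<phi> has_derivative (\<lambda>h. grad \<phi> x \<bullet> h)) (at x)" using d by simp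
  have "continuous_on UNIV (partial_deriv j \<phi>)" for j
    using sm[of "[j]"] by (simp add: differentiable_imp_continuous_on)
  then show "continuous_on UNIV (grad \<phi>)"
    unfolding grad_def by (intro continuous_on_vec_lambda) auto
qed

lemma test_function_zero:
  shows "x \<notin> \<Omega> \<Longrightarrow> \<phi> x = 0" "x \<notin> \<Omega> \<Longrightarrow> grad \<phi> x = 0"
    "x \<notin> closure {x. \<phi> x \<noteq> 0} \<Longrightarrow> grad \<phi> x = 0"
proof -
  show *: "x \<notin> closure {x. \<phi> x \<noteq> 0} \<Longrightarrow> grad \<phi> x = 0" for x
    by (rule gradient_zero_outside_support[OF test_function_gradient(1)]) auto
  show "x \<notin> \<Omega> \<Longrightarrow> \<phi> x = 0"
    using test_function_support(2)[of x] closure_subset[of "{x. \<phi> x \<noteq> 0}"] by auto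
  show "x \<notin> \<Omega> \<Longrightarrow> grad \<phi> x = 0"
    using test_function_support(2)[of x] * by blast
qed

lemma test_function_bounded_C1: "bounded_C1 \<phi> (grad \<phi>)"
  by (rule bounded_C1_compact_support[OF test_function_gradient test_function_support(1)]) auto

lemma test_function_measurable [measurable]:
  "\<phi> \<in> borel_measurable borel" "grad \<phi> \<in> borel_measurable borel"
  by (auto intro!: borel_measurable_continuous_onI test_function_gradient
      bounded_C1_continuous[OF test_function_bounded_C1])

lemma test_function_integrable:
  "integrable lborel (\<lambda>x. \<bar>\<phi> x\<bar>)" "integrable lborel (\<lambda>x. norm (grad \<phi> x))"
proof -
  obtain K where K: "\<And>x. \<bar>\<phi> x\<bar> \<le> K" "\<And>x. norm (grad \<phi> x) \<le> K"
    using bounded_C1_bound[OF test_function_bounded_C1] by metis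
  note S = bounded_closure[OF test_function_support(1)]
  show "integrable lborel (\<lambda>x. \<bar>\<phi> x\<bar>)"
    by (rule integrable_bounded_support[OF _ _ test_function_support(1)]) (use K in auto)
  show "integrable lborel (\<lambda>x. norm (grad \<phi> x))"
    by (rule integrable_bounded_support[OF _ _ S]) (use K test_function_zero(3) in auto)
qed

lemma W11_norm_lborel:
  "W11_norm \<Omega> \<phi> = (\<integral>x. \<bar>\<phi> x\<bar> \<partial>lborel) + (\<integral>x. norm (grad \<phi> x) \<partial>lborel)"
  unfolding W11_norm_def using \<Omega>
  by (subst (1 2) integral_lebesgue_on_eq_lborel) (auto simp: test_function_zero)

lemma integrable_against_gradient:
  fixes v :: "real^3 \<Rightarrow> real^3"
  assumes "continuous_on UNIV v"
  shows "integrable lborel (\<lambda>x. v x \<bullet> grad \<phi> x)"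
proof -
  have "continuous_on UNIV (\<lambda>x. v x \<bullet> grad \<phi> x)"
    by (intro continuous_intros assms test_function_gradient)
  then show ?thesis
    by (rule integrable_continuous_bounded_support[OF _ bounded_closure[OF test_function_support(1)]])
       (simp add: test_function_zero)
qed

lemma Div_component:
  fixes B :: "real^3 \<Rightarrow> real^3^3"
  assumes B: "continuous_on UNIV B"
  shows "Div \<Omega> B \<phi> $ i = - (\<integral>x. (B x $ i) \<bullet> grad \<phi> x \<partial>lborel)"
proof -
  have "(\<lambda>x. (B x $ i) \<bullet> grad \<phi> x) \<in> borel_measurable borel"
    by (intro borel_measurable_continuous_onI continuous_intros B test_function_gradient)
  from integral_lebesgue_on_eq_lborel[OF this, of \<Omega>] \<Omega>
  have "integral\<^sup>L (lebesgue_on \<Omega>) (\<lambda>x. (B x $ i) \<bullet> grad \<phi> x) = (\<integral>x. (B x $ i) \<bullet> grad \<phi> x \<partial>lborel)"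
    by (simp add: test_function_zero)
  then show ?thesis by (simp add: Div_def inner_vec_def grad_def)
qed

text \<open>The weight \<open>f\<close> is not constant, so the field \<open>f \<theta> c\<close> has a divergence although \<open>c\<close> is
  orthogonal to \<open>n\<close>. Integrating by parts along \<open>c\<close>, in which direction the oscillation is constant,
  moves the derivative from the test function to \<open>f\<close>; integrating by parts along \<open>n\<close> then gains
  the factor \<open>1 / s\<close> at the price of one derivative of \<open>\<phi>\<close> and a second one of \<open>f\<close>. The bound
  is in terms of the \<open>W\<^sup>1\<^sup>,\<^sup>1\<close> norm, hence one for the norm of the divergence in
  \<open>W\<^sup>-\<^sup>1\<^sup>,\<^sup>\<infinity>\<close>.\<close>

lemma oscillating_divergence_bound:
  assumes f: "bounded_C1 f F" and D: "bounded_C1 (\<lambda>x. F x \<bullet> c) H"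
    and K: "\<And>x. \<bar>F x \<bullet> c\<bar> \<le> K" "\<And>x. norm (H x) \<le> K"
    and n: "n \<noteq> 0" and cn: "c \<bullet> n = 0" and s: "s > 0"
    and T: "\<And>t. (T has_real_derivative \<theta> t) (at t)" "\<And>t. \<bar>T t\<bar> \<le> 1"
    and \<theta>: "\<And>t. (\<theta> has_real_derivative \<theta>' t) (at t)" "bounded (range \<theta>)" "bounded (range \<theta>')"
      "continuous_on UNIV \<theta>'"
  shows "\<bar>\<integral>x. (f x * \<theta> (s * (n \<bullet> x) + u)) * (c \<bullet> grad \<phi> x) \<partial>lborel\<bar>
    \<le> K * norm n * W11_norm \<Omega> \<phi> / (s * (n \<bullet> n))"
proof -
  let ?D = "\<lambda>x. F x \<bullet> c" and ?\<theta> = "\<lambda>x. \<theta> (s * (n \<bullet> x) + u)"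
  have \<theta>c: "continuous_on UNIV \<theta>"
    using \<theta>(1) by (meson DERIV_isCont continuous_at_imp_continuous_on)
  note C\<theta> = bounded_C1_ridge[OF \<theta>, of s n u]
  note C\<phi> = test_function_bounded_C1
  note supp = test_function_support(1)
  have D\<phi>: "bounded_C1 (\<lambda>x. ?D x * \<phi> x) (\<lambda>x. ?D x *\<^sub>R grad \<phi> x + \<phi> x *\<^sub>R H x)"
    by (rule bounded_C1_mult[OF D C\<phi>])
  have cont: "continuous_on UNIV f" "continuous_on UNIV ?\<theta>" "continuous_on UNIV ?D" "continuous_on UNIV \<phi>"
    using bounded_C1_continuous f C\<theta> D C\<phi> by blast+
  have i1: "integrable lborel (\<lambda>x. (f x * ?\<theta> x) * (c \<bullet> grad \<phi> x))"
  proof -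
    have "continuous_on UNIV (\<lambda>x. (f x * ?\<theta> x) *\<^sub>R c)" by (intro continuous_intros cont)
    from integrable_against_gradient[OF this] show ?thesis by simp
  qed
  have i2: "integrable lborel (\<lambda>x. (?D x * \<phi> x) * ?\<theta> x)"
    by (rule integrable_continuous_bounded_support[OF _ supp]) (auto intro!: continuous_intros cont)
  have "(\<integral>x. ((f x * ?\<theta> x) *\<^sub>R grad \<phi> x
      + \<phi> x *\<^sub>R (f x *\<^sub>R ((s * \<theta>' (s * (n \<bullet> x) + u)) *\<^sub>R n) + ?\<theta> x *\<^sub>R F x)) \<bullet> c \<partial>lborel) = 0"
    by (rule integral_directional_derivative_zero[OF
          bounded_C1_mult[OF bounded_C1_mult[OF f C\<theta>] C\<phi>] supp]) simp
  moreover have "(\<lambda>x. ((f x * ?\<theta> x) *\<^sub>R grad \<phi> x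
      + \<phi> x *\<^sub>R (f x *\<^sub>R ((s * \<theta>' (s * (n \<bullet> x) + u)) *\<^sub>R n) + ?\<theta> x *\<^sub>R F x)) \<bullet> c)
    = (\<lambda>x. (f x * ?\<theta> x) * (c \<bullet> grad \<phi> x) + (?D x * \<phi> x) * ?\<theta> x)"
    using cn by (simp add: fun_eq_iff inner_simps inner_commute[of n c] inner_commute[of _ c])
  ultimately have "(\<integral>x. (f x * ?\<theta> x) * (c \<bullet> grad \<phi> x) \<partial>lborel)
      = - (\<integral>x. (?D x * \<phi> x) * ?\<theta> x \<partial>lborel)"
    using i1 i2 by simp
  moreover have "\<bar>\<integral>x. (?D x * \<phi> x) * ?\<theta> x \<partial>lborel\<bar>
      \<le> (\<integral>x. K * norm n * (\<bar>\<phi> x\<bar> + norm (grad \<phi> x)) \<partial>lborel) / (s * (n \<bullet> n))"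
  proof (rule oscillation_decay[OF D\<phi> supp _ T \<theta>c \<theta>(2) s n])
    show "\<bar>(?D x *\<^sub>R grad \<phi> x + \<phi> x *\<^sub>R H x) \<bullet> n\<bar> \<le> K * norm n * (\<bar>\<phi> x\<bar> + norm (grad \<phi> x))" for x
    proof -
      have "\<bar>(?D x *\<^sub>R grad \<phi> x + \<phi> x *\<^sub>R H x) \<bullet> n\<bar>
          \<le> norm (?D x *\<^sub>R grad \<phi> x + \<phi> x *\<^sub>R H x) * norm n" by (rule Cauchy_Schwarz_ineq2)
      also have "\<dots> \<le> (\<bar>?D x\<bar> * norm (grad \<phi> x) + \<bar>\<phi> x\<bar> * norm (H x)) * norm n"
        by (intro mult_right_mono order_trans[OF norm_triangle_ineq]) auto
      also have "\<dots> \<le> (K * norm (grad \<phi> x) + \<bar>\<phi> x\<bar> * K) * norm n"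
        by (intro mult_right_mono add_mono mult_left_mono mult_right_mono K) auto
      finally show ?thesis by (simp add: algebra_simps)
    qed
  qed (use test_function_integrable in auto)
  ultimately show ?thesis
    using test_function_integrable by (simp add: W11_norm_lborel)
qed

end

text \<open>The bump is \<open>(max 0 (r\<^sup>2 - \<bar>x - x0\<bar>\<^sup>2))\<^sup>2\<close>; one continuous derivative suffices.\<close>

lemma bump_function_exists:
  fixes \<Omega> :: "'a::euclidean_space set"
  assumes "open \<Omega>" "\<Omega> \<noteq> {}"
  shows "\<exists>g G S. bounded_C1 g G \<and> bounded S \<and> closure S \<subseteq> \<Omega> \<and> (\<forall>x. x \<notin> S \<longrightarrow> g x = 0) \<and>
           (\<forall>x. 0 \<le> g x) \<and> 0 < (\<integral>x. g x \<partial>lborel)"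
proof -
  define p where "p = (\<lambda>t::real. (max 0 t)^2)"
  have dp: "(p has_real_derivative 2 * max 0 t) (at t)" for t
  proof -
    consider "t > 0" | "t < 0" | "t = 0" by linarith
    then show ?thesis
    proof cases
      case 1
      have "(p has_real_derivative 2 * t) (at t)"
        by (rule has_field_derivative_transform_within_open[where S = "{0<..}" and f = "\<lambda>t. t^2"])
           (use 1 in \<open>auto simp: p_def intro!: derivative_eq_intros\<close>)
      then show ?thesis using 1 by simp
    next
      case 2
      have "(p has_real_derivative 0) (at t)"
        by (rule has_field_derivative_transform_within_open[where S = "{..<0}" and f = "\<lambda>t. 0"])
           (use 2 in \<open>auto simp: p_def\<close>)
      then show ?thesis using 2 by simp
    next
      case 3
      have "((\<lambda>h. p h / h) \<longlongrightarrow> 0) (at 0)"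
      proof (rule Lim_null_comparison)
        show "\<forall>\<^sub>F h in at 0. norm (p h / h) \<le> \<bar>h\<bar>"
          by (rule always_eventually) (auto simp: p_def max_def power2_eq_square)
        show "((\<lambda>h::real. \<bar>h\<bar>) \<longlongrightarrow> 0) (at 0)" by (auto intro!: tendsto_eq_intros)
      qed
      then show ?thesis using 3 by (simp add: DERIV_def p_def)
    qed
  qed
  obtain x0 r where r: "r > 0" "cball x0 r \<subseteq> \<Omega>"
    using assms open_contains_cball by blast
  define g where "g = (\<lambda>x. p (r^2 - (x - x0) \<bullet> (x - x0)))"
  define G where "G = (\<lambda>x. (2 * max 0 (r^2 - (x - x0) \<bullet> (x - x0))) *\<^sub>R (- 2 *\<^sub>R (x - x0)))"
  have dg: "(g has_derivative (\<lambda>h. G x \<bullet> h)) (at x)" for x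
  proof -
    have "((\<lambda>x. r^2 - (x - x0) \<bullet> (x - x0)) has_derivative (\<lambda>h. - 2 * ((x - x0) \<bullet> h))) (at x)"
      by (auto intro!: derivative_eq_intros simp: inner_commute algebra_simps)
    from has_derivative_compose[OF this dp[unfolded has_field_derivative_def]]
    show ?thesis unfolding g_def G_def by (simp add: algebra_simps)
  qed
  have z: "g x = 0" if "x \<notin> ball x0 r" for x
  proof -
    have "r \<le> norm (x - x0)" using that by (simp add: dist_norm norm_minus_commute)
    then have "r^2 \<le> (x - x0) \<bullet> (x - x0)" using r by (simp add: power_mono flip: power2_norm_eq_inner)
    then show ?thesis by (simp add: g_def p_def)
  qed
  have b: "bounded_C1 g G"
    by (rule bounded_C1_compact_support[OF dg _ bounded_ball z]) (auto simp: G_def intro!: continuous_intros)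
  have nn: "0 \<le> g x" for x by (simp add: g_def p_def)
  have gpos: "g x > 0" if "x \<in> ball x0 r" for x
  proof -
    have "norm (x - x0) < r" using that by (simp add: dist_norm norm_minus_commute)
    then have "(x - x0) \<bullet> (x - x0) < r^2" by (simp add: power_strict_mono flip: power2_norm_eq_inner)
    then show ?thesis by (simp add: g_def p_def)
  qed
  have gm: "g \<in> borel_measurable borel"
    by (intro borel_measurable_continuous_onI bounded_C1_continuous[OF b])
  obtain K where "\<And>x. \<bar>g x\<bar> \<le> K" using bounded_C1_bound[OF b] by metis
  then have gi: "integrable lborel g"
    by (intro integrable_bounded_support[OF gm _ bounded_ball z])
  have "0 < (\<integral>x. g x \<partial>lborel)"
  proof (rule ccontr)
    assume "\<not> 0 < (\<integral>x. g x \<partial>lborel)"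
    moreover have "0 \<le> (\<integral>x. g x \<partial>lborel)" by (intro Bochner_Integration.integral_nonneg nn)
    ultimately have "(\<integral>x. g x \<partial>lborel) = 0" by linarith
    then have "AE x in lborel. g x = 0"
      using integral_nonneg_eq_0_iff_AE[OF gi] nn by simp
    then have "AE x in lborel. x \<notin> ball x0 r"
      by (rule AE_mp) (use gpos in \<open>fastforce intro!: AE_I2\<close>)
    then have "emeasure lborel (ball x0 r) = 0"
      by (subst (asm) AE_iff_measurable[where N = "ball x0 r"]) auto
    then show False
      using content_ball_pos[OF r(1), of x0] by (simp add: measure_def)
  qed
  then show ?thesis using b z nn r
    by (intro exI[of _ g] exI[of _ G] exI[of _ "ball x0 r"]) (auto intro!: subsetD[OF r(2)])
qed

section \<open>Convex combinations and products with oscillating factors\<close>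

lemma integrable_lebesgue_on_bounded:
  fixes u :: "'a::euclidean_space \<Rightarrow> real"
  assumes u: "continuous_on UNIV u" and \<Omega>: "bounded \<Omega>" "\<Omega> \<in> sets borel"
  shows "integrable (lebesgue_on \<Omega>) u"
proof -
  have "integrable lborel (\<lambda>x. indicator \<Omega> x *\<^sub>R u x)"
  proof -
    have "compact (closure \<Omega>)" using \<Omega> by simp
    then have "bounded (u ` closure \<Omega>)"
      using u by (intro compact_imp_bounded compact_continuous_image continuous_on_subset[OF u]) auto
    then obtain k where k: "\<And>x. x \<in> closure \<Omega> \<Longrightarrow> \<bar>u x\<bar> \<le> k" by (auto simp: bounded_iff)
    have [measurable]: "u \<in> borel_measurable borel" by (rule borel_measurable_continuous_onI[OF u])
    have "\<bar>indicator \<Omega> x *\<^sub>R u x\<bar> \<le> max 0 k" for x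
      using k[of x] closure_subset[of \<Omega>] by (auto simp: indicator_def le_max_iff_disj)
    then show ?thesis
      using \<Omega> by (intro integrable_bounded_support[of _ "max 0 k" \<Omega>]) auto
  qed
  then have "integrable lebesgue (\<lambda>x. indicator \<Omega> x *\<^sub>R u x)"
    by (simp add: integrable_completion)
  then show ?thesis using \<Omega>(2) by (subst integrable_restrict_space) auto
qed

text \<open>The distance is at most \<open>2 R t\<close> (compare with \<open>X\<close>) and at most
  \<open>infdist Z K + 2 R (1 - t)\<close> (compare with \<open>Z\<close>); average the two bounds with the weights
  \<open>1 - t\<close> and \<open>t\<close>. The error \<open>t (1 - t)\<close> is small unless \<open>t\<close> is in a transition layer.\<close>

lemma infdist_convex_combination:
  fixes X Z :: "'a::real_normed_vector"
  assumes "X \<in> K" "norm X \<le> R" "norm Z \<le> R" "0 \<le> t" "t \<le> 1"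
  shows "infdist ((1 - t) *\<^sub>R X + t *\<^sub>R Z) K \<le> 4 * R * (t * (1 - t)) + t * infdist Z K"
proof -
  let ?Y = "(1 - t) *\<^sub>R X + t *\<^sub>R Z"
  have XZ: "norm (Z - X) \<le> 2 * R"
    using norm_triangle_ineq4[of Z X] assms by simp
  have "?Y - X = t *\<^sub>R (Z - X)" "?Y - Z = (t - 1) *\<^sub>R (Z - X)" by (simp_all add: algebra_simps)
  then have "dist ?Y X = t * norm (Z - X)" "dist ?Y Z = (1 - t) * norm (Z - X)"
    using assms by (simp_all add: dist_norm)
  then have d: "dist ?Y X \<le> t * (2 * R)" "dist ?Y Z \<le> (1 - t) * (2 * R)"
    using XZ assms by (simp_all add: mult_left_mono)
  have "infdist ?Y K \<le> t * (2 * R)"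
    using infdist_le[OF assms(1), of ?Y] d by simp
  moreover have "infdist ?Y K \<le> infdist Z K + (1 - t) * (2 * R)"
    using infdist_triangle[of ?Y K Z] d by simp
  ultimately have "(1 - t) * infdist ?Y K + t * infdist ?Y K
      \<le> (1 - t) * (t * (2 * R)) + t * (infdist Z K + (1 - t) * (2 * R))"
    using assms by (intro add_mono mult_left_mono) auto
  then show ?thesis by (simp add: algebra_simps)
qed

lemma norm_convex_combination_le:
  fixes X Z :: "'a::real_normed_vector"
  assumes "norm X \<le> R" "norm Z \<le> R" "0 \<le> t" "t \<le> 1"
  shows "norm ((1 - t) *\<^sub>R X + t *\<^sub>R Z) \<le> R"
proof -
  have "norm ((1 - t) *\<^sub>R X + t *\<^sub>R Z) \<le> (1 - t) * norm X + t * norm Z"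
    using assms by (intro order_trans[OF norm_triangle_ineq]) simp
  also have "\<dots> \<le> (1 - t) * R + t * R" using assms by (intro add_mono mult_left_mono) auto
  finally show ?thesis by (simp add: algebra_simps)
qed

lemma oscillating_rows_divergence_bound:
  fixes \<Omega> :: "(real^3) set" and C :: "real^3^3"
  assumes \<Omega>: "open \<Omega>" and f: "bounded_C2 f F" and n: "n \<noteq> 0" and Cn: "C *v n = 0"
    and T: "\<And>t. (T has_real_derivative \<theta> t) (at t)" "\<And>t. \<bar>T t\<bar> \<le> 1"
    and \<theta>: "\<And>t. (\<theta> has_real_derivative \<theta>' t) (at t)" "bounded (range \<theta>)" "bounded (range \<theta>')"
      "continuous_on UNIV \<theta>'"
  shows "\<exists>A. \<forall>s>0. \<forall>u i. \<forall>\<phi>\<in>test_functions \<Omega>.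
    \<bar>\<integral>x. (f x * \<theta> (s * (n \<bullet> x) + u)) * (C $ i \<bullet> grad \<phi> x) \<partial>lborel\<bar> \<le> A / s * W11_norm \<Omega> \<phi>"
proof -
  have "\<exists>k. \<exists>H. bounded_C1 (\<lambda>x. F x \<bullet> C $ i) H \<and> (\<forall>x. \<bar>F x \<bullet> C $ i\<bar> \<le> k) \<and> (\<forall>x. norm (H x) \<le> k)" for i
  proof -
    obtain H where H: "bounded_C1 (\<lambda>x. F x \<bullet> C $ i) H" using f unfolding bounded_C2_def by blast
    show ?thesis using bounded_C1_bound[OF H] H by metis
  qed
  then obtain k where k: "\<And>i. \<exists>H. bounded_C1 (\<lambda>x. F x \<bullet> C $ i) H \<and>
      (\<forall>x. \<bar>F x \<bullet> C $ i\<bar> \<le> k i) \<and> (\<forall>x. norm (H x) \<le> k i)" by metis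
  define A where "A = (MAX i. k i) * norm n / (n \<bullet> n)"
  have "\<bar>\<integral>x. (f x * \<theta> (s * (n \<bullet> x) + u)) * (C $ i \<bullet> grad \<phi> x) \<partial>lborel\<bar> \<le> A / s * W11_norm \<Omega> \<phi>"
    if s: "s > 0" and \<phi>: "\<phi> \<in> test_functions \<Omega>" for s u i \<phi>
  proof -
    obtain H where H: "bounded_C1 (\<lambda>x. F x \<bullet> C $ i) H" "\<And>x. \<bar>F x \<bullet> C $ i\<bar> \<le> k i" "\<And>x. norm (H x) \<le> k i"
      using k[of i] by blast
    have le: "k i \<le> (MAX i. k i)" by (intro Max_ge) auto
    have "C $ i \<bullet> n = 0"
      using Cn by (metis matrix_vector_mul_component zero_index)
    moreover have "bounded_C1 f F" using f by (simp add: bounded_C2_def)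
    ultimately have "\<bar>\<integral>x. (f x * \<theta> (s * (n \<bullet> x) + u)) * (C $ i \<bullet> grad \<phi> x) \<partial>lborel\<bar>
        \<le> (MAX i. k i) * norm n * W11_norm \<Omega> \<phi> / (s * (n \<bullet> n))"
      by (intro oscillating_divergence_bound[OF \<Omega> \<phi> _ H(1) order_trans[OF H(2) le]
            order_trans[OF H(3) le] n _ s T \<theta>])
    then show ?thesis by (simp add: A_def field_simps)
  qed
  then show ?thesis by blast
qed

lemma oscillation_weakly_null:
  fixes n :: "'a::euclidean_space"
  assumes g: "bounded_C1 g G" and S: "bounded S" "\<And>x. x \<notin> S \<Longrightarrow> g x = 0" and n: "n \<noteq> 0"
    and T: "\<And>t. (T has_real_derivative \<theta> t) (at t)" "\<And>t. \<bar>T t\<bar> \<le> 1"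
    and \<theta>: "continuous_on UNIV \<theta>" "bounded (range \<theta>)"
  shows "\<exists>A. \<forall>s>0. \<forall>u. \<bar>\<integral>x. g x * \<theta> (s * (n \<bullet> x) + u) \<partial>lborel\<bar> \<le> A / s"
proof -
  have Gc: "continuous_on UNIV G" using g by (simp add: bounded_C1_def)
  have z: "G x = 0" if "x \<notin> closure S" for x
    by (rule gradient_zero_outside_support[OF _ S(2) that]) (use g in \<open>auto simp: bounded_C1_def\<close>)
  obtain k where "\<And>x. norm (G x) \<le> k" using bounded_C1_bound[OF g] by metis
  then have "\<bar>\<bar>G x \<bullet> n\<bar>\<bar> \<le> k * norm n" for x
    using Cauchy_Schwarz_ineq2[of "G x" n] mult_right_mono[of "norm (G x)" k "norm n"]
    by (simp add: order_trans)
  then have "integrable lborel (\<lambda>x. \<bar>G x \<bullet> n\<bar>)"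
    by (intro integrable_bounded_support[OF _ _ bounded_closure[OF S(1)]]
        borel_measurable_continuous_onI continuous_intros Gc) (auto simp: z)
  from oscillation_decay[OF g S T \<theta> _ n this]
  show ?thesis
    by (intro exI[of _ "(\<integral>x. \<bar>G x \<bullet> n\<bar> \<partial>lborel) / (n \<bullet> n)"]) (simp add: field_simps)
qed

lemma Div_add_scaled:
  fixes B :: "real^3 \<Rightarrow> real^3^3" and C :: "real^3^3"
  assumes \<Omega>: "open \<Omega>" "\<phi> \<in> test_functions \<Omega>" and B: "continuous_on UNIV B" and f: "continuous_on UNIV f"
  shows "Div \<Omega> (\<lambda>x. B x + f x *\<^sub>R C) \<phi> $ i
    = Div \<Omega> B \<phi> $ i - (\<integral>x. f x * (C $ i \<bullet> grad \<phi> x) \<partial>lborel)"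
proof -
  have "continuous_on UNIV (\<lambda>x. B x $ i)" "continuous_on UNIV (\<lambda>x. f x *\<^sub>R C $ i)"
    by (intro continuous_intros B f)+
  note int = this[THEN integrable_against_gradient[OF \<Omega>]]
  have "Div \<Omega> (\<lambda>x. B x + f x *\<^sub>R C) \<phi> $ i
      = - (\<integral>x. (B x $ i) \<bullet> grad \<phi> x + (f x *\<^sub>R C $ i) \<bullet> grad \<phi> x \<partial>lborel)"
    by (subst Div_component[OF \<Omega>]) (auto intro!: continuous_intros B f simp: inner_add_left)
  then show ?thesis using int by (simp add: Div_component[OF \<Omega> B])
qed

lemma scaled_gradient_integral_bound:
  assumes \<Omega>: "open \<Omega>" "\<phi> \<in> test_functions \<Omega>" and f: "continuous_on UNIV f" "\<And>x. \<bar>f x\<bar> \<le> b"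
  shows "\<bar>\<integral>x. f x * (v \<bullet> grad \<phi> x) \<partial>lborel\<bar> \<le> b * norm v * W11_norm \<Omega> \<phi>"
proof -
  have "continuous_on UNIV (\<lambda>x. f x *\<^sub>R v)" by (intro continuous_intros f)
  from integrable_against_gradient[OF \<Omega> this]
  have i: "integrable lborel (\<lambda>x. f x * (v \<bullet> grad \<phi> x))" by simp
  have b: "b \<ge> 0" using f(2) order_trans abs_ge_zero by blast
  have "norm (\<integral>x. f x * (v \<bullet> grad \<phi> x) \<partial>lborel) \<le> (\<integral>x. b * norm v * norm (grad \<phi> x) \<partial>lborel)"
  proof (rule Bochner_Integration.integral_norm_bound_integral[OF i])
    show "integrable lborel (\<lambda>x. b * norm v * norm (grad \<phi> x))"
      using test_function_integrable(2)[OF \<Omega>] by simp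
    show "norm (f x * (v \<bullet> grad \<phi> x)) \<le> b * norm v * norm (grad \<phi> x)" for x
      using mult_mono[OF f(2) Cauchy_Schwarz_ineq2[of v "grad \<phi> x"] b abs_ge_zero]
      by (simp add: abs_mult mult.assoc)
  qed
  also have "\<dots> = b * norm v * (\<integral>x. norm (grad \<phi> x) \<partial>lborel)"
    by simp
  also have "\<dots> \<le> b * norm v * W11_norm \<Omega> \<phi>"
    unfolding W11_norm_lborel[OF \<Omega>] using b
    by (intro mult_left_mono) (auto intro!: Bochner_Integration.integral_nonneg)
  finally show ?thesis by simp
qed

section \<open>Infinite laminates\<close>

text \<open>Each \<open>P k\<close> is a mixture of a matrix \<open>X k\<close> of \<open>K\<close> and of the next point \<open>P (Suc k)\<close>, and
  the two can be layered with normal \<open>n k\<close>: a field that depends on \<open>n k \<bullet> x\<close> only and takes values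
  on the segment between them has divergence zero, because their difference annihilates \<open>n k\<close>.\<close>

locale infinite_laminate =
  fixes K :: "(real^3^3) set" and X P :: "nat \<Rightarrow> real^3^3" and n :: "nat \<Rightarrow> real^3"
    and q :: "nat \<Rightarrow> real" and q0 R :: real
  assumes X_in_K: "X k \<in> K" and X_bound: "norm (X k) \<le> R" and P_bound: "norm (P k) \<le> R"
    and n_nonzero: "n k \<noteq> 0" and q0_pos: "0 < q0" and q0_le: "q0 \<le> q k" and q_less: "q k < 1"
    and split: "P k = q k *\<^sub>R X k + (1 - q k) *\<^sub>R P (Suc k)"
    and compatible: "(P (Suc k) - X k) *v n k = 0"

text \<open>The function \<open>g\<close> tests the weak convergence of the fields to \<open>P 0\<close>; \<open>L\<close> is the weight that the
  choice of the phases gives to the transition layers relative to the part still to be split.\<close>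

locale laminate_construction = infinite_laminate +
  fixes \<Omega> :: "(real^3) set" and g :: "real^3 \<Rightarrow> real" and G :: "real^3 \<Rightarrow> real^3"
    and S :: "(real^3) set" and L :: real
  assumes \<Omega>: "open \<Omega>" "bounded \<Omega>"
    and g: "bounded_C1 g G" "bounded S" "\<And>x. x \<notin> S \<Longrightarrow> g x = 0" "\<And>x. 0 \<le> g x"
    and L_pos: "L > 0"
begin

text \<open>After \<open>k\<close> splittings the field is \<open>V + f P k\<close>. The number \<open>f x\<close> is the weight of the part
  that still has to be split, \<open>V\<close> is the contribution of the matrices \<open>X j\<close> that are already
  reached, and \<open>e\<close> collects the terms \<open>t (1 - t)\<close> of the transition layers. The pointwise bounds
  are for an arbitrary matrix \<open>Z\<close> in place of \<open>P k\<close>, because the next splitting substitutes a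
  mixture for it. The budget \<open>L \<integral>e + \<integral>f \<le> \<bar>\<Omega>\<bar>\<close> gives \<open>\<integral>e \<le> \<bar>\<Omega>\<bar> / L\<close>
  for any number of splittings.\<close>

definition stage :: "nat \<Rightarrow> real \<Rightarrow> (real^3 \<Rightarrow> real) \<Rightarrow> (real^3 \<Rightarrow> real) \<Rightarrow> (real^3 \<Rightarrow> real^3^3) \<Rightarrow> bool" where
  "stage k \<eta> f e V \<longleftrightarrow>
     (\<exists>F. bounded_C2 f F) \<and> (\<forall>x. 0 \<le> f x \<and> f x \<le> 1) \<and>
     continuous_on UNIV e \<and> continuous_on UNIV V \<and>
     (\<forall>x Z. norm Z \<le> R \<longrightarrow> norm (V x + f x *\<^sub>R Z) \<le> R \<and>
        infdist (V x + f x *\<^sub>R Z) K \<le> 4 * R * e x + f x * infdist Z K) \<and>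
     L * (\<integral>x. e x \<partial>lebesgue_on \<Omega>) + (\<integral>x. f x \<partial>lebesgue_on \<Omega>) \<le> measure lebesgue \<Omega> \<and>
     (\<integral>x. f x \<partial>lebesgue_on \<Omega>) \<le> (1 - q0 / 2) ^ k * measure lebesgue \<Omega> \<and>
     (\<forall>\<phi>\<in>test_functions \<Omega>. norm (Div \<Omega> (\<lambda>x. V x + f x *\<^sub>R P k) \<phi>) \<le> \<eta> * W11_norm \<Omega> \<phi>) \<and>
     norm (\<integral>x. g x *\<^sub>R (V x + f x *\<^sub>R P k - P 0) \<partial>lborel) \<le> \<eta>"

lemma stage_0: "stage 0 0 (\<lambda>_. 1) (\<lambda>_. 0) (\<lambda>_. 0)"
proof -
  have "bounded_C1 (\<lambda>x. c) (\<lambda>x. 0)" for c :: real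
    by (simp add: bounded_C1_def image_constant_conv)
  then have 1: "\<exists>F. bounded_C2 (\<lambda>x. 1) F"
    by (intro exI[of _ "\<lambda>x. 0"]) (auto simp: bounded_C2_def)
  have 2: "Div \<Omega> (\<lambda>x. P 0) \<phi> = 0" if "\<phi> \<in> test_functions \<Omega>" for \<phi>
  proof -
    have "Div \<Omega> (\<lambda>x. P 0) \<phi> $ i = 0" for i
      using integral_directional_derivative_zero[OF test_function_bounded_C1 test_function_support(1),
          OF \<Omega>(1) that \<Omega>(1) that, of "P 0 $ i"]
      by (simp add: Div_component[OF \<Omega>(1) that] inner_commute)
    then show ?thesis by (simp add: vec_eq_iff)
  qed
  have "W11_norm \<Omega> \<phi> \<ge> 0" for \<phi>
    unfolding W11_norm_def by (intro add_nonneg_nonneg Bochner_Integration.integral_nonneg) auto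
  then show ?thesis
    unfolding stage_def using 1 2 \<Omega> by (simp add: measure_restrict_space)
qed

text \<open>Replacing \<open>P k\<close> by the mixture \<open>(1 - \<sigma>) X k + \<sigma> P (Suc k)\<close>, where \<open>\<sigma>\<close> is a switching profile
  along \<open>n k\<close>, adds \<open>f (\<sigma> - a) C\<close> to the field, where \<open>C = P (Suc k) - X k\<close> and \<open>a = 1 - q k\<close>.
  Since \<open>C\<close> annihilates \<open>n k\<close>, a high frequency, and a profile with mean close to \<open>a\<close>, make the
  effect on the divergence and on the weak limit as small as desired, whatever the phase. The phase is chosen afterwards, so that the part
  still to be split shrinks by a fixed factor.\<close>

lemma stage_Suc:
  assumes st: "stage k \<eta> f e V" and \<eta>': "\<eta>' > 0"
  shows "\<exists>f' e' V'. stage (Suc k) (\<eta> + \<eta>') f' e' V'"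
proof -
  obtain F where F: "bounded_C2 f F" and F1: "bounded_C1 f F"
    using st unfolding stage_def bounded_C2_def by blast
  have f01: "0 \<le> f x" "f x \<le> 1" for x using st by (auto simp: stage_def)
  have cont: "continuous_on UNIV e" "continuous_on UNIV V" "continuous_on UNIV f" "continuous_on UNIV g"
    using st bounded_C1_continuous[OF F1] bounded_C1_continuous[OF g(1)] by (auto simp: stage_def)
  have \<Omega>s: "\<Omega> \<in> sets borel" using \<Omega> by simp
  note int\<Omega> = integrable_lebesgue_on_bounded[OF _ \<Omega>(2) \<Omega>s]
  define C where "C = P (Suc k) - X k"
  define a where "a = 1 - q k"
  define \<gamma> where "\<gamma> = (\<integral>x. g x \<partial>lborel)"
  have \<gamma>: "\<gamma> \<ge> 0" unfolding \<gamma>_def by (intro Bochner_Integration.integral_nonneg g)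
  \<comment> \<open>The first bound on \<open>\<delta>\<close> serves the contraction, the second one the error of the mean \<open>m\<close>.\<close>
  define \<delta> where "\<delta> = min (q0 / (2 * (1 + L))) (\<eta>' / (2 * (norm C + 1) * (3 + \<gamma>)))"
  have den: "2 * (norm C + 1) * (3 + \<gamma>) > 0"
    using \<gamma> by (intro mult_pos_pos add_nonneg_pos add_pos_nonneg) auto
  have \<delta>: "\<delta> > 0" "(1 + L) * \<delta> \<le> q0 / 2" "norm C * (3 + \<gamma>) * \<delta> \<le> \<eta>' / 2"
  proof -
    show "\<delta> > 0" using q0_pos L_pos \<eta>' den by (auto simp: \<delta>_def)
    then have d0: "\<delta> \<ge> 0" by simp
    have "(1 + L) * \<delta> \<le> (1 + L) * (q0 / (2 * (1 + L)))"
      using L_pos by (intro mult_left_mono) (auto simp: \<delta>_def)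
    also have "\<dots> = q0 / 2" using L_pos by (simp add: field_simps)
    finally show "(1 + L) * \<delta> \<le> q0 / 2" .
    have "norm C * (3 + \<gamma>) * \<delta> \<le> (norm C + 1) * (3 + \<gamma>) * \<delta>"
      using \<gamma> d0 by (intro mult_right_mono) auto
    also have "\<dots> \<le> (norm C + 1) * (3 + \<gamma>) * (\<eta>' / (2 * (norm C + 1) * (3 + \<gamma>)))"
      using \<gamma> by (intro mult_left_mono) (auto simp: \<delta>_def)
    also have "\<dots> = \<eta>' / 2"
    proof -
      have "norm C + 1 \<noteq> 0" "3 + \<gamma> \<noteq> 0" using \<gamma> norm_ge_zero[of C] by linarith+
      then show ?thesis by (simp add: divide_simps)
    qed
    finally show "norm C * (3 + \<gamma>) * \<delta> \<le> \<eta>' / 2" .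
  qed
  have "0 < a" "a < 1" using q_less[of k] q0_pos q0_le[of k] by (auto simp: a_def)
  then obtain c where c: "switching_profile a \<delta> c" using switching_profile_exists \<delta>(1) by blast
  have c01: "0 \<le> c t" "c t \<le> 1" for t using c by (auto simp: switching_profile_def)
  obtain c' c'' where c': "\<And>t. (c has_real_derivative c' t) (at t)" "\<And>t. (c' has_real_derivative c'' t) (at t)"
    "bounded (range c')" "bounded (range c'')" "continuous_on UNIV c''"
    using c unfolding switching_profile_def by blast
  obtain m T where m: "\<bar>m - a\<bar> \<le> \<delta>" "\<And>s. integral {0..1} (\<lambda>t. c (s + t)) = m"
    and T: "\<And>t. (T has_real_derivative c t - m) (at t)" "\<And>t. \<bar>T t\<bar> \<le> 1"
    using c unfolding switching_profile_def by blast
  obtain d where d: "d \<le> \<delta>" "\<And>s. integral {0..1} (\<lambda>t. c (s + t) * (1 - c (s + t))) = d"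
    using c unfolding switching_profile_def by blast
  define \<theta> where "\<theta> = (\<lambda>t. c t - m)"
  have c_cont: "continuous_on UNIV c" and c'_cont: "continuous_on UNIV c'"
    using c' by (meson DERIV_isCont continuous_at_imp_continuous_on)+
  have c_bdd: "bounded (range c)" using c01 by (auto simp: bounded_iff intro!: exI[of _ 1])
  have \<theta>: "\<And>t. (\<theta> has_real_derivative c' t) (at t)" "bounded (range \<theta>)" "continuous_on UNIV \<theta>"
  proof -
    show "(\<theta> has_real_derivative c' t) (at t)" for t
      unfolding \<theta>_def using DERIV_diff[OF c'(1) DERIV_const, of m t] by simp
    show "bounded (range \<theta>)"
      unfolding \<theta>_def by (rule bounded_minus_comp[OF c_bdd]) (simp add: image_constant_conv)
    show "continuous_on UNIV \<theta>" unfolding \<theta>_def by (intro continuous_intros c_cont)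
  qed
  have T\<theta>: "\<And>t. (T has_real_derivative \<theta> t) (at t)" using T by (simp add: \<theta>_def)
  have Cn: "C *v n k = 0" using compatible by (simp add: C_def)
  obtain A1 where A1: "\<And>s u i \<phi>. s > 0 \<Longrightarrow> \<phi> \<in> test_functions \<Omega> \<Longrightarrow>
    \<bar>\<integral>x. (f x * \<theta> (s * (n k \<bullet> x) + u)) * (C $ i \<bullet> grad \<phi> x) \<partial>lborel\<bar> \<le> A1 / s * W11_norm \<Omega> \<phi>"
    using oscillating_rows_divergence_bound[OF \<Omega>(1) F n_nonzero[of k] Cn T\<theta> T(2)
      \<theta>(1,2) c'(3) c'_cont] by blast
  obtain A2 where A2: "\<And>s u. s > 0 \<Longrightarrow> \<bar>\<integral>x. (g x * f x) * \<theta> (s * (n k \<bullet> x) + u) \<partial>lborel\<bar> \<le> A2 / s"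
    using oscillation_weakly_null[OF bounded_C1_mult[OF g(1) F1] g(2) _ n_nonzero[of k] T\<theta> T(2) \<theta>(3,2)] g(3)
    by force
  \<comment> \<open>The frequency makes both oscillation errors at most \<open>\<eta>' / 2\<close>; the factor 3 below counts the rows.\<close>
  define s where "s = 1 + (6 * \<bar>A1\<bar> + 2 * \<bar>A2\<bar> * norm C) / \<eta>'"
  have s: "s > 0" unfolding s_def using \<eta>' by (intro add_pos_nonneg divide_nonneg_pos) auto
  have s\<eta>: "s * \<eta>' = \<eta>' + 6 * \<bar>A1\<bar> + 2 * \<bar>A2\<bar> * norm C" using \<eta>' by (simp add: s_def field_simps)
  have A1s: "3 * (A1 / s) \<le> \<eta>' / 2"
  proof -
    have "6 * A1 \<le> s * \<eta>'" unfolding s\<eta> using \<eta>' by (simp add: add_increasing add_increasing2)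
    then show ?thesis using s by (simp add: field_simps)
  qed
  have A2s: "A2 / s * norm C \<le> \<eta>' / 2"
  proof -
    have "A2 * norm C \<le> \<bar>A2\<bar> * norm C" by (intro mult_right_mono) auto
    then have "2 * (A2 * norm C) \<le> s * \<eta>'" unfolding s\<eta> using \<eta>' abs_ge_zero[of A1] by linarith
    then show ?thesis using s by (simp add: field_simps)
  qed
  interpret M: finite_measure "lebesgue_on \<Omega>"
    by (rule finite_measure_lebesgue_on) (use \<Omega> in \<open>simp add: lmeasurable_open\<close>)
  \<comment> \<open>A single choice of the phase has to control both \<open>f \<sigma>\<close> and the new transition layers.\<close>
  define h where "h = (\<lambda>t. c t + L * (c t * (1 - c t)))"
  obtain u where u: "(\<integral>x. f x * h (s * (n k \<bullet> x) + u) \<partial>lebesgue_on \<Omega>)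
      \<le> (m + L * d) * (\<integral>x. f x \<partial>lebesgue_on \<Omega>)"
  proof -
    have "\<exists>u. (\<integral>x. f x * h (s * (n k \<bullet> x) + u) \<partial>lebesgue_on \<Omega>)
      \<le> (m + L * d) * (\<integral>x. f x \<partial>lebesgue_on \<Omega>)"
    proof (rule M.exists_phase_below_mean)
      show "integrable (lebesgue_on \<Omega>) f" by (rule int\<Omega>[OF cont(3)])
      have "integrable (lebesgue_on \<Omega>) (\<lambda>x. s * (n k \<bullet> x))"
        by (intro int\<Omega> continuous_intros)
      then show "(\<lambda>x. s * (n k \<bullet> x)) \<in> borel_measurable (lebesgue_on \<Omega>)" by auto
      show "continuous_on UNIV h" unfolding h_def by (intro continuous_intros c_cont)
      show "0 \<le> h t" "h t \<le> 1 + L" for t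
      proof -
        have p: "0 \<le> c t * (1 - c t)" "c t * (1 - c t) \<le> 1" using c01[of t] by (auto intro: mult_le_one)
        show "0 \<le> h t" "h t \<le> 1 + L"
          using c01[of t] mult_left_mono[OF p(2), of L] mult_nonneg_nonneg[OF _ p(1), of L] L_pos
          unfolding h_def by linarith+
      qed
      show "integral {0..1} (\<lambda>t. h (z + t)) = m + L * d" for z
      proof -
        have cz: "continuous_on {0..1} (\<lambda>t. c (z + t))"
          by (intro continuous_on_compose2[OF c_cont] continuous_intros) auto
        have "(\<lambda>t. c (z + t)) integrable_on {0..1}" "(\<lambda>t. L * (c (z + t) * (1 - c (z + t)))) integrable_on {0..1}"
          by (intro integrable_continuous_real continuous_intros cz)+
        then show ?thesis
          using m(2)[of z] d(2)[of z] by (simp add: h_def Henstock_Kurzweil_Integration.integral_add)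
      qed
    qed (rule f01)
    then show ?thesis using that by blast
  qed
  define \<sigma> where "\<sigma> = (\<lambda>x. c (s * (n k \<bullet> x) + u))"
  have \<sigma>01: "0 \<le> \<sigma> x" "\<sigma> x \<le> 1" for x using c01 by (auto simp: \<sigma>_def)
  have \<sigma>_C2: "\<exists>H. bounded_C2 \<sigma> H"
    unfolding \<sigma>_def using bounded_C2_ridge[OF c'(1,2) c_bdd c'(3-5)] by blast
  have \<sigma>_cont: "continuous_on UNIV \<sigma>"
    using \<sigma>_C2 bounded_C1_continuous by (auto simp: bounded_C2_def)
  define f' where "f' = (\<lambda>x. f x * \<sigma> x)"
  define e' where "e' = (\<lambda>x. e x + f x * (\<sigma> x * (1 - \<sigma> x)))"
  define V' where "V' = (\<lambda>x. V x + (f x * (1 - \<sigma> x)) *\<^sub>R X k)"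
  define B where "B = (\<lambda>x. V x + f x *\<^sub>R P k)"
  have B_cont: "continuous_on UNIV B" unfolding B_def by (intro continuous_intros cont)
  have \<theta>_cont: "continuous_on UNIV (\<lambda>x. f x * \<theta> (s * (n k \<bullet> x) + u))"
    using \<sigma>_cont by (auto simp: \<theta>_def \<sigma>_def intro!: continuous_intros cont)
  have B': "V' x + f' x *\<^sub>R P (Suc k)
      = (B x + (f x * \<theta> (s * (n k \<bullet> x) + u)) *\<^sub>R C) + ((m - a) * f x) *\<^sub>R C" for x
  proof -
    have Pk: "P k = X k + a *\<^sub>R C" by (subst split) (simp add: a_def C_def algebra_simps)
    have \<theta>\<sigma>: "\<theta> (s * (n k \<bullet> x) + u) = \<sigma> x - m" by (simp add: \<theta>_def \<sigma>_def)
    have PS: "P (Suc k) = X k + C" by (simp add: C_def)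
    show ?thesis unfolding V'_def f'_def B_def Pk PS \<theta>\<sigma> by (simp add: algebra_simps)
  qed
  have mf: "\<bar>(m - a) * f x\<bar> \<le> \<delta>" for x
    using mult_mono[of "\<bar>m - a\<bar>" \<delta> "\<bar>f x\<bar>" 1] m(1) f01[of x] \<delta>(1) by (simp add: abs_mult)

  have "\<exists>F'. bounded_C2 f' F'" unfolding f'_def using bounded_C2_mult F \<sigma>_C2 by blast
  moreover have "0 \<le> f' x \<and> f' x \<le> 1" for x
    using f01 \<sigma>01 by (simp add: f'_def mult_le_one)
  moreover have "continuous_on UNIV e'" "continuous_on UNIV V'"
    unfolding e'_def V'_def by (intro continuous_intros cont \<sigma>_cont)+
  moreover have "norm (V' x + f' x *\<^sub>R Z) \<le> R \<and>
        infdist (V' x + f' x *\<^sub>R Z) K \<le> 4 * R * e' x + f' x * infdist Z K" if Z: "norm Z \<le> R" for x Z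
  proof -
    let ?Y = "(1 - \<sigma> x) *\<^sub>R X k + \<sigma> x *\<^sub>R Z"
    have eq: "V' x + f' x *\<^sub>R Z = V x + f x *\<^sub>R ?Y"
      by (simp add: V'_def f'_def algebra_simps)
    have Y: "norm ?Y \<le> R" by (rule norm_convex_combination_le[OF X_bound Z \<sigma>01])
    have "infdist ?Y K \<le> 4 * R * (\<sigma> x * (1 - \<sigma> x)) + \<sigma> x * infdist Z K"
      by (rule infdist_convex_combination[OF X_in_K X_bound Z \<sigma>01])
    then have "f x * infdist ?Y K \<le> f x * (4 * R * (\<sigma> x * (1 - \<sigma> x)) + \<sigma> x * infdist Z K)"
      using f01 by (intro mult_left_mono) auto
    moreover have "norm (V x + f x *\<^sub>R ?Y) \<le> R"
      "infdist (V x + f x *\<^sub>R ?Y) K \<le> 4 * R * e x + f x * infdist ?Y K"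
      using st Y unfolding stage_def by blast+
    ultimately show ?thesis
      unfolding eq by (simp add: e'_def f'_def algebra_simps)
  qed
  moreover have contraction: "(\<integral>x. f' x \<partial>lebesgue_on \<Omega>) + L * (\<integral>x. f x * (\<sigma> x * (1 - \<sigma> x)) \<partial>lebesgue_on \<Omega>)
      \<le> (1 - q0 / 2) * (\<integral>x. f x \<partial>lebesgue_on \<Omega>)"
  proof -
    have i: "integrable (lebesgue_on \<Omega>) f'" "integrable (lebesgue_on \<Omega>) (\<lambda>x. f x * (\<sigma> x * (1 - \<sigma> x)))"
      unfolding f'_def by (intro int\<Omega> continuous_intros cont \<sigma>_cont)+
    have "(\<lambda>x. f x * h (s * (n k \<bullet> x) + u)) = (\<lambda>x. f' x + L * (f x * (\<sigma> x * (1 - \<sigma> x))))"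
      by (simp add: fun_eq_iff h_def f'_def \<sigma>_def algebra_simps)
    then have "(\<integral>x. f' x \<partial>lebesgue_on \<Omega>) + L * (\<integral>x. f x * (\<sigma> x * (1 - \<sigma> x)) \<partial>lebesgue_on \<Omega>)
        \<le> (m + L * d) * (\<integral>x. f x \<partial>lebesgue_on \<Omega>)"
      using u i by simp
    also have "\<dots> \<le> (1 - q0 / 2) * (\<integral>x. f x \<partial>lebesgue_on \<Omega>)"
    proof (rule mult_right_mono)
      have "m \<le> a + \<delta>" using m(1) by linarith
      moreover have "L * d \<le> L * \<delta>" using d(1) L_pos by simp
      moreover have "a \<le> 1 - q0" using q0_le[of k] by (simp add: a_def)
      moreover have "\<delta> + L * \<delta> \<le> q0 / 2" using \<delta>(2) by (simp add: algebra_simps)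
      ultimately show "m + L * d \<le> 1 - q0 / 2" by linarith
    qed (auto intro!: Bochner_Integration.integral_nonneg f01)
    finally show ?thesis .
  qed
  have f_nn: "0 \<le> (\<integral>x. f x \<partial>lebesgue_on \<Omega>)" "0 \<le> (\<integral>x. f x * (\<sigma> x * (1 - \<sigma> x)) \<partial>lebesgue_on \<Omega>)"
    using f01 \<sigma>01 by (auto intro!: Bochner_Integration.integral_nonneg)
  have "L * (\<integral>x. e' x \<partial>lebesgue_on \<Omega>) + (\<integral>x. f' x \<partial>lebesgue_on \<Omega>) \<le> measure lebesgue \<Omega>"
  proof -
    have "(\<integral>x. e' x \<partial>lebesgue_on \<Omega>)
        = (\<integral>x. e x \<partial>lebesgue_on \<Omega>) + (\<integral>x. f x * (\<sigma> x * (1 - \<sigma> x)) \<partial>lebesgue_on \<Omega>)"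
      unfolding e'_def
      by (intro Bochner_Integration.integral_add int\<Omega> continuous_intros cont \<sigma>_cont)
    moreover have "(1 - q0 / 2) * (\<integral>x. f x \<partial>lebesgue_on \<Omega>) \<le> (\<integral>x. f x \<partial>lebesgue_on \<Omega>)"
      using f_nn(1) q0_pos by (simp add: algebra_simps)
    moreover have "L * (\<integral>x. e x \<partial>lebesgue_on \<Omega>) + (\<integral>x. f x \<partial>lebesgue_on \<Omega>) \<le> measure lebesgue \<Omega>"
      using st by (simp add: stage_def)
    ultimately show ?thesis using contraction by (simp add: distrib_left)
  qed
  moreover have "(\<integral>x. f' x \<partial>lebesgue_on \<Omega>) \<le> (1 - q0 / 2) ^ Suc k * measure lebesgue \<Omega>"
  proof -
    have "q0 < 1" using q0_le[of k] q_less[of k] by linarith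
    have "(\<integral>x. f' x \<partial>lebesgue_on \<Omega>) \<le> (1 - q0 / 2) * (\<integral>x. f x \<partial>lebesgue_on \<Omega>)"
      using contraction mult_nonneg_nonneg[OF less_imp_le[OF L_pos] f_nn(2)] by linarith
    also have "\<dots> \<le> (1 - q0 / 2) * ((1 - q0 / 2) ^ k * measure lebesgue \<Omega>)"
      using st \<open>q0 < 1\<close> by (intro mult_left_mono) (auto simp: stage_def)
    finally show ?thesis by (simp add: mult.assoc)
  qed
  moreover have "norm (Div \<Omega> (\<lambda>x. V' x + f' x *\<^sub>R P (Suc k)) \<phi>) \<le> (\<eta> + \<eta>') * W11_norm \<Omega> \<phi>"
    if \<phi>: "\<phi> \<in> test_functions \<Omega>" for \<phi>
  proof -
    let ?W = "W11_norm \<Omega> \<phi>" and ?D = "Div \<Omega> (\<lambda>x. V' x + f' x *\<^sub>R P (Suc k)) \<phi>"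
    have W0: "?W \<ge> 0"
      unfolding W11_norm_def by (intro add_nonneg_nonneg Bochner_Integration.integral_nonneg) auto
    have comp: "\<bar>(?D - Div \<Omega> B \<phi>) $ i\<bar> \<le> (A1 / s + \<delta> * norm C) * ?W" for i
    proof -
      have "?D $ i = Div \<Omega> B \<phi> $ i
          - (\<integral>x. (f x * \<theta> (s * (n k \<bullet> x) + u)) * (C $ i \<bullet> grad \<phi> x) \<partial>lborel)
          - (\<integral>x. ((m - a) * f x) * (C $ i \<bullet> grad \<phi> x) \<partial>lborel)"
        unfolding B'
        by (subst Div_add_scaled[OF \<Omega>(1) \<phi>])
           (auto intro!: continuous_intros B_cont \<theta>_cont cont simp: Div_add_scaled[OF \<Omega>(1) \<phi> B_cont \<theta>_cont])
      moreover have "\<bar>\<integral>x. ((m - a) * f x) * (C $ i \<bullet> grad \<phi> x) \<partial>lborel\<bar> \<le> \<delta> * norm (C $ i) * ?W"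
        by (rule scaled_gradient_integral_bound[OF \<Omega>(1) \<phi> _ mf]) (intro continuous_intros cont)
      moreover have "\<delta> * norm (C $ i) * ?W \<le> \<delta> * norm C * ?W"
        using \<delta>(1) W0 by (intro mult_right_mono mult_left_mono Finite_Cartesian_Product.norm_nth_le) auto
      ultimately show ?thesis using A1[OF s \<phi>, of u i] by (simp add: algebra_simps)
    qed
    have "norm (?D - Div \<Omega> B \<phi>) \<le> (\<Sum>i\<in>UNIV. \<bar>(?D - Div \<Omega> B \<phi>) $ i\<bar>)" by (rule norm_le_l1_cart)
    also have "\<dots> \<le> (\<Sum>i\<in>(UNIV :: 3 set). (A1 / s + \<delta> * norm C) * ?W)" by (intro sum_mono comp)
    also have "\<dots> = (3 * (A1 / s) + 3 * (\<delta> * norm C)) * ?W" by (simp add: algebra_simps)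
    also have "\<dots> \<le> \<eta>' * ?W"
    proof (rule mult_right_mono[OF _ W0])
      have "norm C * 3 * \<delta> \<le> norm C * (3 + \<gamma>) * \<delta>"
        using \<gamma> \<delta>(1) by (intro mult_right_mono mult_left_mono) auto
      moreover have "3 * (\<delta> * norm C) = norm C * 3 * \<delta>" by simp
      ultimately show "3 * (A1 / s) + 3 * (\<delta> * norm C) \<le> \<eta>'" using \<delta>(3) A1s by linarith
    qed
    finally have "norm (?D - Div \<Omega> B \<phi>) \<le> \<eta>' * ?W" .
    moreover have "norm (Div \<Omega> B \<phi>) \<le> \<eta> * ?W" using st \<phi> by (simp add: stage_def B_def)
    ultimately have "norm ?D \<le> \<eta> * ?W + \<eta>' * ?W"
      using norm_triangle_ineq[of "Div \<Omega> B \<phi>" "?D - Div \<Omega> B \<phi>"] by simp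
    then show ?thesis by (simp add: algebra_simps)
  qed
  moreover have "norm (\<integral>x. g x *\<^sub>R (V' x + f' x *\<^sub>R P (Suc k) - P 0) \<partial>lborel) \<le> \<eta> + \<eta>'"
  proof -
    have i: "integrable lborel (\<lambda>x. g x *\<^sub>R (B x - P 0))"
      "integrable lborel (\<lambda>x. (g x * f x) * \<theta> (s * (n k \<bullet> x) + u))"
      "integrable lborel (\<lambda>x. g x * f x)" "integrable lborel g"
    proof -
      have "continuous_on UNIV (\<lambda>x. g x * (f x * \<theta> (s * (n k \<bullet> x) + u)))"
        by (intro continuous_intros cont \<theta>_cont)
      then have "integrable lborel (\<lambda>x. g x * (f x * \<theta> (s * (n k \<bullet> x) + u)))"
        by (rule integrable_continuous_bounded_support[OF _ g(2)]) (simp add: g)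
      then show "integrable lborel (\<lambda>x. (g x * f x) * \<theta> (s * (n k \<bullet> x) + u))"
        by (simp add: mult.assoc)
    qed (rule integrable_continuous_bounded_support[OF _ g(2)];
          auto intro!: continuous_intros cont B_cont simp: g(3))+
    have "(\<lambda>x. g x *\<^sub>R (V' x + f' x *\<^sub>R P (Suc k) - P 0))
      = (\<lambda>x. g x *\<^sub>R (B x - P 0) + ((g x * f x) * \<theta> (s * (n k \<bullet> x) + u)) *\<^sub>R C
             + ((m - a) * (g x * f x)) *\<^sub>R C)"
      unfolding B' by (simp add: fun_eq_iff algebra_simps)
    then have "(\<integral>x. g x *\<^sub>R (V' x + f' x *\<^sub>R P (Suc k) - P 0) \<partial>lborel)
      = (\<integral>x. g x *\<^sub>R (B x - P 0) \<partial>lborel)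
        + (\<integral>x. (g x * f x) * \<theta> (s * (n k \<bullet> x) + u) \<partial>lborel) *\<^sub>R C
        + ((m - a) * (\<integral>x. g x * f x \<partial>lborel)) *\<^sub>R C"
      using i by simp
    moreover have "norm (\<integral>x. g x *\<^sub>R (B x - P 0) \<partial>lborel) \<le> \<eta>"
      using st by (simp add: stage_def B_def)
    moreover have "norm ((\<integral>x. (g x * f x) * \<theta> (s * (n k \<bullet> x) + u) \<partial>lborel) *\<^sub>R C) \<le> A2 / s * norm C"
      using mult_right_mono[OF A2[OF s, of u], of "norm C"] by simp
    moreover have "norm (((m - a) * (\<integral>x. g x * f x \<partial>lborel)) *\<^sub>R C) \<le> \<delta> * \<gamma> * norm C"
    proof -
      have "0 \<le> (\<integral>x. g x * f x \<partial>lborel)"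
        by (intro Bochner_Integration.integral_nonneg mult_nonneg_nonneg g f01)
      moreover have "(\<integral>x. g x * f x \<partial>lborel) \<le> \<gamma>"
        unfolding \<gamma>_def by (intro integral_mono i mult_left_le f01 g)
      ultimately have "\<bar>m - a\<bar> * \<bar>\<integral>x. g x * f x \<partial>lborel\<bar> \<le> \<delta> * \<gamma>"
        using m(1) \<delta>(1) by (intro mult_mono) auto
      then show ?thesis by (simp add: abs_mult mult_right_mono)
    qed
    moreover have "\<delta> * \<gamma> * norm C \<le> \<eta>' / 2"
    proof -
      have "norm C * \<gamma> * \<delta> \<le> norm C * (3 + \<gamma>) * \<delta>"
        using \<delta>(1) by (intro mult_right_mono mult_left_mono) auto
      moreover have "\<delta> * \<gamma> * norm C = norm C * \<gamma> * \<delta>" by simp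
      ultimately show ?thesis using \<delta>(3) by linarith
    qed
    ultimately show ?thesis using A2s
      by (smt (verit) norm_triangle_ineq field_sum_of_halves)
  qed
  ultimately have "stage (Suc k) (\<eta> + \<eta>') f' e' V'"
    unfolding stage_def by blast
  then show ?thesis by blast
qed

lemma stage_exists:
  assumes "\<eta> > 0"
  shows "\<exists>f e V. stage k (real k * \<eta>) f e V"
proof (induction k)
  case 0
  then show ?case using stage_0 by auto
next
  case (Suc k)
  then obtain f e V where "stage k (real k * \<eta>) f e V" by blast
  from stage_Suc[OF this assms] show ?case by (simp add: algebra_simps)
qed

end

lemma continuous_borel_measurable_lebesgue_on:
  assumes "continuous_on UNIV f"
  shows "f \<in> borel_measurable (lebesgue_on \<Omega>)"
proof -
  have "f \<in> borel_measurable lborel" using borel_measurable_continuous_onI[OF assms] by simp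
  then show ?thesis by (intro measurable_restrict_space1 measurable_completion)
qed

lemma tendsto_zero_in_measure_of_integral:
  assumes u: "\<And>h. integrable (lebesgue_on \<Omega>) (u h)" "\<And>h x. 0 \<le> u h x"
    and lim: "(\<lambda>h. \<integral>x. u h x \<partial>lebesgue_on \<Omega>) \<longlonglongrightarrow> 0"
  shows "tendsto_zero_in_measure \<Omega> u"
  unfolding tendsto_zero_in_measure_def
proof (intro allI impI)
  fix \<epsilon> :: real assume \<epsilon>: "\<epsilon> > 0"
  show "(\<lambda>h. emeasure (lebesgue_on \<Omega>) {x \<in> \<Omega>. \<bar>u h x\<bar> > \<epsilon>}) \<longlonglongrightarrow> 0"
  proof (rule tendsto_sandwich[OF _ _ tendsto_const])
    show "\<forall>\<^sub>F h in sequentially. emeasure (lebesgue_on \<Omega>) {x \<in> \<Omega>. \<bar>u h x\<bar> > \<epsilon>}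
        \<le> ennreal ((1 / \<epsilon>) * (\<integral>x. u h x \<partial>lebesgue_on \<Omega>))"
    proof (rule always_eventually, rule allI)
      fix h
      have m: "u h \<in> borel_measurable (lebesgue_on \<Omega>)" using u(1) by auto
      have "{x \<in> space (lebesgue_on \<Omega>). u h x \<ge> \<epsilon>} \<in> sets (lebesgue_on \<Omega>)"
        using m by measurable
      then have "emeasure (lebesgue_on \<Omega>) {x \<in> \<Omega>. \<bar>u h x\<bar> > \<epsilon>}
          \<le> emeasure (lebesgue_on \<Omega>) {x \<in> space (lebesgue_on \<Omega>). u h x \<ge> \<epsilon>}"
        by (intro emeasure_mono) (use u(2) in \<open>auto simp: abs_of_nonneg\<close>)
      also have "\<dots> \<le> ennreal ((1 / \<epsilon>) * (\<integral>x. u h x \<partial>lebesgue_on \<Omega>))"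
        by (rule integral_Markov_inequality[OF u(1) _ \<epsilon>]) (simp add: u(2))
      finally show "emeasure (lebesgue_on \<Omega>) {x \<in> \<Omega>. \<bar>u h x\<bar> > \<epsilon>}
        \<le> ennreal ((1 / \<epsilon>) * (\<integral>x. u h x \<partial>lebesgue_on \<Omega>))" .
    qed
    show "(\<lambda>h. ennreal ((1 / \<epsilon>) * (\<integral>x. u h x \<partial>lebesgue_on \<Omega>))) \<longlonglongrightarrow> 0"
      using tendsto_ennrealI[OF tendsto_mult_right_zero[OF lim, of "1 / \<epsilon>"]] by simp
  qed simp
qed

lemma integral_tendsto_zero_of_measure:
  fixes u :: "nat \<Rightarrow> real^3 \<Rightarrow> real"
  assumes \<Omega>: "open \<Omega>" "bounded \<Omega>" and u: "\<And>h. continuous_on UNIV (u h)"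
    and b: "\<And>h x. 0 \<le> u h x" "\<And>h x. u h x \<le> b"
    and lim: "tendsto_zero_in_measure \<Omega> u"
  shows "(\<lambda>h. \<integral>x. u h x \<partial>lebesgue_on \<Omega>) \<longlonglongrightarrow> 0"
proof (rule tendstoI)
  fix r :: real assume r: "r > 0"
  interpret M: finite_measure "lebesgue_on \<Omega>"
    by (rule finite_measure_lebesgue_on) (use \<Omega> in \<open>simp add: lmeasurable_open\<close>)
  define \<mu> where "\<mu> = measure (lebesgue_on \<Omega>) \<Omega>"
  have b0: "b \<ge> 0" using b order_trans by blast
  have \<mu>0: "\<mu> \<ge> 0" by (simp add: \<mu>_def)
  define \<epsilon> where "\<epsilon> = r / (2 * (\<mu> + 1))"
  have \<epsilon>: "\<epsilon> > 0" "\<epsilon> * \<mu> < r / 2" using r \<mu>0 by (auto simp: \<epsilon>_def field_simps add_pos_nonneg)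
  define D where "D = (\<lambda>h. {x \<in> \<Omega>. \<bar>u h x\<bar> > \<epsilon>})"
  have um: "u h \<in> borel_measurable (lebesgue_on \<Omega>)" for h
    by (rule continuous_borel_measurable_lebesgue_on[OF u])
  have ui: "integrable (lebesgue_on \<Omega>) (u h)" for h
    by (rule integrable_lebesgue_on_bounded[OF u]) (use \<Omega> in auto)
  have Dm: "D h \<in> sets (lebesgue_on \<Omega>)" for h
  proof -
    have "{x \<in> space (lebesgue_on \<Omega>). \<bar>u h x\<bar> > \<epsilon>} \<in> sets (lebesgue_on \<Omega>)"
      using um[of h] by measurable
    then show ?thesis by (simp add: D_def)
  qed
  have D\<Omega>: "D h \<inter> \<Omega> = D h" for h by (auto simp: D_def)
  have "r / (2 * (b + 1)) > 0" using r b0 by simp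
  moreover have "(\<lambda>h. emeasure (lebesgue_on \<Omega>) (D h)) \<longlonglongrightarrow> 0"
    using lim \<epsilon>(1) by (simp add: tendsto_zero_in_measure_def D_def)
  ultimately have "\<forall>\<^sub>F h in sequentially. emeasure (lebesgue_on \<Omega>) (D h) < ennreal (r / (2 * (b + 1)))"
    by (intro order_tendstoD(2)[of _ 0]) auto
  then show "\<forall>\<^sub>F h in sequentially. dist (\<integral>x. u h x \<partial>lebesgue_on \<Omega>) 0 < r"
  proof eventually_elim
    case (elim h)
    have "measure (lebesgue_on \<Omega>) (D h) < r / (2 * (b + 1))"
      using elim by (subst (asm) M.emeasure_eq_measure) (simp add: ennreal_less_iff)
    then have "b * measure (lebesgue_on \<Omega>) (D h) \<le> b * (r / (2 * (b + 1)))"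
      using b0 by (intro mult_left_mono) auto
    also have "\<dots> \<le> r / 2" using b0 r by (simp add: field_simps)
    finally have bD: "b * measure (lebesgue_on \<Omega>) (D h) \<le> r / 2" .
    have "(\<integral>x. u h x \<partial>lebesgue_on \<Omega>) \<le> (\<integral>x. \<epsilon> + b * indicator (D h) x \<partial>lebesgue_on \<Omega>)"
    proof (rule integral_mono[OF ui])
      show "integrable (lebesgue_on \<Omega>) (\<lambda>x. \<epsilon> + b * indicator (D h) x)"
        using Dm by (intro Bochner_Integration.integrable_add integrable_mult_right
            integrable_real_indicator M.integrable_const) (auto simp: M.emeasure_eq_measure)
      show "u h x \<le> \<epsilon> + b * indicator (D h) x" if "x \<in> space (lebesgue_on \<Omega>)" for x
        using that b(2)[of h x] \<epsilon>(1) by (auto simp: D_def indicator_def)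
    qed
    also have "\<dots> = \<epsilon> * \<mu> + b * measure (lebesgue_on \<Omega>) (D h)"
      using Dm by (subst Bochner_Integration.integral_add)
        (auto simp: \<mu>_def D\<Omega> M.emeasure_eq_measure integrable_real_indicator)
    finally have "(\<integral>x. u h x \<partial>lebesgue_on \<Omega>) < r" using bD \<epsilon>(2) by linarith
    moreover have "0 \<le> (\<integral>x. u h x \<partial>lebesgue_on \<Omega>)" by (intro Bochner_Integration.integral_nonneg b)
    ultimately show ?case by simp
  qed
qed

section \<open>Non-rigidity from infinite laminates\<close>

context infinite_laminate
begin

lemma R_nonneg: "0 \<le> R"
  using X_bound[of 0] norm_ge_zero order_trans by blast

text \<open>With \<open>k\<close> large the unsplit part is small, and with \<open>L\<close> large the transition layers are; the
  errors in the divergence and in the weak limit are divided among the \<open>k\<close> splittings.\<close>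

lemma approximating_field:
  assumes \<Omega>: "open \<Omega>" "bounded \<Omega>" and \<epsilon>: "\<epsilon> > 0"
    and g: "bounded_C1 g G" "bounded S" "\<And>x. x \<notin> S \<Longrightarrow> g x = 0" "\<And>x. 0 \<le> g x"
  shows "\<exists>B. continuous_on UNIV B \<and> (\<forall>x. norm (B x) \<le> R) \<and>
    (\<forall>\<phi>\<in>test_functions \<Omega>. norm (Div \<Omega> B \<phi>) \<le> \<epsilon> * W11_norm \<Omega> \<phi>) \<and>
    (\<integral>x. infdist (B x) K \<partial>lebesgue_on \<Omega>) \<le> \<epsilon> \<and>
    norm (\<integral>x. g x *\<^sub>R (B x - P 0) \<partial>lborel) \<le> \<epsilon>"
proof -
  define \<mu> where "\<mu> = measure lebesgue \<Omega>"
  have \<mu>: "\<mu> \<ge> 0" by (simp add: \<mu>_def)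
  define L where "L = 1 + 8 * R * \<mu> / \<epsilon>"
  have L: "L > 0" unfolding L_def using \<epsilon> \<mu> R_nonneg by (intro add_pos_nonneg) auto
  interpret laminate_construction K X P n q q0 R \<Omega> g G S L
    by unfold_locales (use \<Omega> g L in auto)
  have "(\<lambda>k. 2 * R * ((1 - q0 / 2) ^ k * \<mu>)) \<longlonglongrightarrow> 2 * R * (0 * \<mu>)"
    using q0_pos q0_le[of 0] q_less[of 0] by (intro tendsto_intros LIMSEQ_power_zero) auto
  then have "\<forall>\<^sub>F k in sequentially. 2 * R * ((1 - q0 / 2) ^ k * \<mu>) < \<epsilon> / 2"
    using \<epsilon> by (intro order_tendstoD(2)[of _ "2 * R * (0 * \<mu>)"]) auto
  then obtain k where k: "2 * R * ((1 - q0 / 2) ^ k * \<mu>) < \<epsilon> / 2"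
    by (auto dest: eventually_happens'[OF sequentially_bot])
  define \<eta> where "\<eta> = \<epsilon> / (real k + 1)"
  have \<eta>: "\<eta> > 0" "real k * \<eta> \<le> \<epsilon>" using \<epsilon> by (auto simp: \<eta>_def field_simps)
  obtain f e V where st: "stage k (real k * \<eta>) f e V" using stage_exists[OF \<eta>(1)] by blast
  define B where "B = (\<lambda>x. V x + f x *\<^sub>R P k)"
  obtain F where "bounded_C1 f F" using st unfolding stage_def bounded_C2_def by blast
  then have cont: "continuous_on UNIV f" "continuous_on UNIV V" "continuous_on UNIV e"
    using bounded_C1_continuous st by (auto simp: stage_def)
  have Bc: "continuous_on UNIV B" unfolding B_def by (intro continuous_intros cont)
  have \<Omega>s: "\<Omega> \<in> sets borel" using \<Omega> by simp
  note int\<Omega> = integrable_lebesgue_on_bounded[OF _ \<Omega>(2) \<Omega>s]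
  have "(\<integral>x. infdist (B x) K \<partial>lebesgue_on \<Omega>) \<le> (\<integral>x. 4 * R * e x + 2 * R * f x \<partial>lebesgue_on \<Omega>)"
  proof (rule integral_mono)
    show "integrable (lebesgue_on \<Omega>) (\<lambda>x. infdist (B x) K)"
      "integrable (lebesgue_on \<Omega>) (\<lambda>x. 4 * R * e x + 2 * R * f x)"
      by (intro int\<Omega> continuous_intros cont Bc)+
    fix x
    have "infdist (P k) K \<le> dist (P k) (X k)" by (rule infdist_le[OF X_in_K])
    also have "\<dots> \<le> 2 * R"
      using norm_triangle_ineq4[of "P k" "X k"] P_bound[of k] X_bound[of k] by (simp add: dist_norm)
    finally have "f x * infdist (P k) K \<le> f x * (2 * R)"
      using st by (intro mult_left_mono) (auto simp: stage_def)
    moreover have "infdist (B x) K \<le> 4 * R * e x + f x * infdist (P k) K"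
      using st P_bound unfolding stage_def B_def by blast
    ultimately show "infdist (B x) K \<le> 4 * R * e x + 2 * R * f x" by (simp add: mult.commute)
  qed
  also have "\<dots> = 4 * R * (\<integral>x. e x \<partial>lebesgue_on \<Omega>) + 2 * R * (\<integral>x. f x \<partial>lebesgue_on \<Omega>)"
    using int\<Omega>[OF cont(1)] int\<Omega>[OF cont(3)] by simp
  also have "\<dots> \<le> \<epsilon> / 2 + \<epsilon> / 2"
  proof (rule add_mono)
    have "0 \<le> (\<integral>x. f x \<partial>lebesgue_on \<Omega>)"
      using st by (intro Bochner_Integration.integral_nonneg) (auto simp: stage_def)
    moreover have "L * (\<integral>x. e x \<partial>lebesgue_on \<Omega>) + (\<integral>x. f x \<partial>lebesgue_on \<Omega>) \<le> \<mu>"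
      using st by (simp add: stage_def \<mu>_def)
    ultimately have "(\<integral>x. e x \<partial>lebesgue_on \<Omega>) \<le> \<mu> / L" using L by (simp add: pos_le_divide_eq mult.commute)
    then have "4 * R * (\<integral>x. e x \<partial>lebesgue_on \<Omega>) \<le> 4 * R * (\<mu> / L)"
      using R_nonneg by (intro mult_left_mono) auto
    also have "\<dots> \<le> \<epsilon> / 2"
    proof -
      have "8 * R * \<mu> \<le> \<epsilon> * L" using \<epsilon> by (simp add: L_def field_simps)
      then show ?thesis using L by (simp add: field_simps)
    qed
    finally show "4 * R * (\<integral>x. e x \<partial>lebesgue_on \<Omega>) \<le> \<epsilon> / 2" .
    have "2 * R * (\<integral>x. f x \<partial>lebesgue_on \<Omega>) \<le> 2 * R * ((1 - q0 / 2) ^ k * \<mu>)"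
      using st R_nonneg by (intro mult_left_mono) (auto simp: stage_def \<mu>_def)
    then show "2 * R * (\<integral>x. f x \<partial>lebesgue_on \<Omega>) \<le> \<epsilon> / 2" using k by linarith
  qed
  finally have "(\<integral>x. infdist (B x) K \<partial>lebesgue_on \<Omega>) \<le> \<epsilon>" by simp
  moreover have "norm (B x) \<le> R" for x
    using st P_bound unfolding stage_def B_def by blast
  moreover have "norm (Div \<Omega> B \<phi>) \<le> \<epsilon> * W11_norm \<Omega> \<phi>" if "\<phi> \<in> test_functions \<Omega>" for \<phi>
  proof -
    have "0 \<le> W11_norm \<Omega> \<phi>"
      unfolding W11_norm_def by (intro add_nonneg_nonneg Bochner_Integration.integral_nonneg) auto
    then have "real k * \<eta> * W11_norm \<Omega> \<phi> \<le> \<epsilon> * W11_norm \<Omega> \<phi>" using \<eta> by (intro mult_right_mono)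
    moreover have "norm (Div \<Omega> B \<phi>) \<le> real k * \<eta> * W11_norm \<Omega> \<phi>"
      using st that unfolding stage_def B_def by blast
    ultimately show ?thesis by linarith
  qed
  moreover have "norm (\<integral>x. g x *\<^sub>R (B x - P 0) \<partial>lborel) \<le> \<epsilon>"
    using st \<eta> unfolding stage_def B_def by linarith
  ultimately show ?thesis using Bc by blast
qed

text \<open>The fields are bounded, so if they converged in measure to some \<open>A'\<close> in \<open>K\<close>, they would converge
  to it in \<open>L\<^sup>1\<close>. But integrated against the bump \<open>g\<close> they converge to \<open>P 0\<close>, which is not
  in \<open>K\<close>.\<close>

lemma non_rigid:
  assumes \<Omega>: "open \<Omega>" "bounded \<Omega>" "\<Omega> \<noteq> {}" and P0: "P 0 \<notin> K"
  shows "non_rigid_approx \<Omega> K"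
proof -
  obtain g G S where g: "bounded_C1 g G" "bounded S" "closure S \<subseteq> \<Omega>" "\<And>x. x \<notin> S \<Longrightarrow> g x = 0"
    "\<And>x. 0 \<le> g x" and gpos: "0 < (\<integral>x. g x \<partial>lborel)"
    using bump_function_exists[OF \<Omega>(1,3)] by blast
  define approximates where "approximates = (\<lambda>h B. continuous_on UNIV B \<and> (\<forall>x. norm (B x) \<le> R) \<and>
    (\<forall>\<phi>\<in>test_functions \<Omega>. norm (Div \<Omega> B \<phi>) \<le> inverse (real (Suc h)) * W11_norm \<Omega> \<phi>) \<and>
    (\<integral>x. infdist (B x) K \<partial>lebesgue_on \<Omega>) \<le> inverse (real (Suc h)) \<and>
    norm (\<integral>x. g x *\<^sub>R (B x - P 0) \<partial>lborel) \<le> inverse (real (Suc h)))"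
  have "\<exists>B. approximates h B" for h
    unfolding approximates_def by (rule approximating_field[OF \<Omega>(1,2) _ g(1,2,4,5)]) auto
  then obtain B where appr: "\<And>h. approximates h (B h)" by metis
  have B: "\<And>h. continuous_on UNIV (B h)" "\<And>h x. norm (B h x) \<le> R"
    "\<And>h \<phi>. \<phi> \<in> test_functions \<Omega> \<Longrightarrow> norm (Div \<Omega> (B h) \<phi>) \<le> inverse (real (Suc h)) * W11_norm \<Omega> \<phi>"
    "\<And>h. (\<integral>x. infdist (B h x) K \<partial>lebesgue_on \<Omega>) \<le> inverse (real (Suc h))"
    "\<And>h. norm (\<integral>x. g x *\<^sub>R (B h x - P 0) \<partial>lborel) \<le> inverse (real (Suc h))"
    using appr unfolding approximates_def by blast+
  have \<Omega>s: "\<Omega> \<in> sets borel" using \<Omega> by simp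
  note int\<Omega> = integrable_lebesgue_on_bounded[OF _ \<Omega>(2) \<Omega>s]
  have "uniformly_bounded_Linf \<Omega> B"
    unfolding uniformly_bounded_Linf_def
    using B(1,2) by (auto intro!: continuous_borel_measurable_lebesgue_on exI[of _ R])
  moreover have "(\<lambda>h. Wneg1inf_norm \<Omega> (Div \<Omega> (B h))) \<longlonglongrightarrow> 0"
  proof (rule tendsto_sandwich[OF _ _ tendsto_const])
    show "\<forall>\<^sub>F h in sequentially. Wneg1inf_norm \<Omega> (Div \<Omega> (B h)) \<le> ennreal (inverse (real (Suc h)))"
    proof (rule always_eventually, rule allI)
      fix h
      show "Wneg1inf_norm \<Omega> (Div \<Omega> (B h)) \<le> ennreal (inverse (real (Suc h)))"
        unfolding Wneg1inf_norm_def
      proof (rule SUP_least, rule ennreal_leI)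
        fix \<phi> assume "\<phi> \<in> {\<phi> \<in> test_functions \<Omega>. W11_norm \<Omega> \<phi> \<le> 1}"
        then have "norm (Div \<Omega> (B h) \<phi>) \<le> inverse (real (Suc h)) * W11_norm \<Omega> \<phi>"
          "inverse (real (Suc h)) * W11_norm \<Omega> \<phi> \<le> inverse (real (Suc h)) * 1"
          using B(3)[of \<phi> h] by (auto intro!: mult_left_mono simp del: of_nat_Suc)
        then show "norm (Div \<Omega> (B h) \<phi>) \<le> inverse (real (Suc h))" by linarith
      qed
    qed
    show "(\<lambda>h. ennreal (inverse (real (Suc h)))) \<longlonglongrightarrow> 0"
      using tendsto_ennrealI[OF LIMSEQ_inverse_real_of_nat] by simp
  qed simp
  moreover have "tendsto_zero_in_measure \<Omega> (\<lambda>h x. infdist (B h x) K)"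
  proof (rule tendsto_zero_in_measure_of_integral)
    show "integrable (lebesgue_on \<Omega>) (\<lambda>x. infdist (B h x) K)" for h
      by (intro int\<Omega> continuous_intros B)
    show "(\<lambda>h. \<integral>x. infdist (B h x) K \<partial>lebesgue_on \<Omega>) \<longlonglongrightarrow> 0"
      by (rule tendsto_sandwich[OF _ _ tendsto_const LIMSEQ_inverse_real_of_nat])
         (auto intro!: always_eventually B(4) Bochner_Integration.integral_nonneg infdist_nonneg simp del: of_nat_Suc)
  qed (rule infdist_nonneg)
  moreover have "\<not> tendsto_zero_in_measure \<Omega> (\<lambda>h x. dist (B h x) A')" if "A' \<in> K" for A'
  proof
    assume lim: "tendsto_zero_in_measure \<Omega> (\<lambda>h x. dist (B h x) A')"
    have L1: "(\<lambda>h. \<integral>x. dist (B h x) A' \<partial>lebesgue_on \<Omega>) \<longlonglongrightarrow> 0"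
    proof (rule integral_tendsto_zero_of_measure[OF \<Omega>(1,2) _ _ _ lim])
      show "dist (B h x) A' \<le> R + norm A'" for h x
        using norm_triangle_ineq4[of "B h x" A'] B(2)[of h x] by (simp add: dist_norm)
    qed (auto intro!: continuous_intros B)
    obtain Kg where Kg: "Kg > 0" "\<And>x. \<bar>g x\<bar> \<le> Kg" using bounded_C1_bound[OF g(1)] by metis
    define Q where "Q = (\<integral>x. g x \<partial>lborel) *\<^sub>R (P 0 - A')"
    have gc: "continuous_on UNIV g" by (rule bounded_C1_continuous[OF g(1)])
    have le: "norm Q \<le> Kg * (\<integral>x. dist (B h x) A' \<partial>lebesgue_on \<Omega>) + inverse (real (Suc h))" for h
    proof -
      have i: "integrable lborel (\<lambda>x. g x *\<^sub>R (B h x - A'))" "integrable lborel (\<lambda>x. g x *\<^sub>R (B h x - P 0))"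
        "integrable lborel g" "integrable lborel (\<lambda>x. g x * dist (B h x) A')"
        by (rule integrable_continuous_bounded_support[OF _ g(2)];
            auto intro!: continuous_intros gc B simp: g(4))+
      have eq: "g x *\<^sub>R (P 0 - A') = g x *\<^sub>R (B h x - A') - g x *\<^sub>R (B h x - P 0)" for x
        by (simp add: scaleR_diff_right)
      have "Q = (\<integral>x. g x *\<^sub>R (P 0 - A') \<partial>lborel)"
        unfolding Q_def by (rule integral_scaleR_left[symmetric]) (rule i(3))
      then have "Q = (\<integral>x. g x *\<^sub>R (B h x - A') \<partial>lborel) - (\<integral>x. g x *\<^sub>R (B h x - P 0) \<partial>lborel)"
        unfolding eq using Bochner_Integration.integral_diff[OF i(1,2)] by (rule trans)
      then have "norm Q \<le> norm (\<integral>x. g x *\<^sub>R (B h x - A') \<partial>lborel) + norm (\<integral>x. g x *\<^sub>R (B h x - P 0) \<partial>lborel)"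
        using norm_triangle_ineq4 by (rule ord_eq_le_trans[OF arg_cong])
      also have "\<dots> \<le> norm (\<integral>x. g x *\<^sub>R (B h x - A') \<partial>lborel) + inverse (real (Suc h))"
        using B(5)[of h] by simp
      also have "norm (\<integral>x. g x *\<^sub>R (B h x - A') \<partial>lborel) \<le> (\<integral>x. g x * dist (B h x) A' \<partial>lborel)"
        using g(5) by (intro Bochner_Integration.integral_norm_bound_integral i) (simp add: dist_norm)
      also have "\<dots> = (\<integral>x. g x * dist (B h x) A' \<partial>lebesgue_on \<Omega>)"
        using g(3) closure_subset[of S]
        by (intro integral_lebesgue_on_eq_lborel[symmetric] \<Omega>s borel_measurable_continuous_onI
            continuous_intros gc B) (auto intro!: g(4))
      also have "\<dots> \<le> (\<integral>x. Kg * dist (B h x) A' \<partial>lebesgue_on \<Omega>)"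
        using Kg by (intro integral_mono int\<Omega> continuous_intros gc B mult_right_mono)
          (auto intro: order_trans[OF abs_ge_self])
      also have "\<dots> = Kg * (\<integral>x. dist (B h x) A' \<partial>lebesgue_on \<Omega>)" by simp
      finally show ?thesis by simp
    qed
    have "(\<lambda>h. Kg * (\<integral>x. dist (B h x) A' \<partial>lebesgue_on \<Omega>) + inverse (real (Suc h))) \<longlonglongrightarrow> Kg * 0 + 0"
      by (intro tendsto_intros L1 LIMSEQ_inverse_real_of_nat)
    then have "norm Q \<le> Kg * 0 + 0" by (rule LIMSEQ_le_const) (use le in blast)
    then have "Q = 0" by simp
    then have "P 0 = A'" using gpos by (simp add: Q_def)
    then show False using P0 that by simp
  qed
  ultimately show ?thesis unfolding non_rigid_approx_def by blast
qed

end

section \<open>The three-matrix set\<close>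

lemma matrix_inv_eigenvector:
  fixes G :: "real^3^3"
  assumes "invertible G"
  shows "(matrix_inv G ** diag_matrix v ** G) *v (matrix_inv G *v axis i 1) = v $ i *\<^sub>R (matrix_inv G *v axis i 1)"
    and "matrix_inv G *v axis i 1 \<noteq> 0"
proof -
  have "G ** matrix_inv G = mat 1"
    using someI_ex[OF assms[unfolded invertible_def]] by (simp add: matrix_inv_def)
  then have G: "G *v (matrix_inv G *v axis i 1) = axis i 1"
    by (simp add: matrix_vector_mul_assoc)
  have D: "diag_matrix v *v axis i 1 = v $ i *\<^sub>R axis i 1"
    unfolding matrix_vector_mult_basis by (simp add: column_def diag_matrix_def axis_def vec_eq_iff)
  show "(matrix_inv G ** diag_matrix v ** G) *v (matrix_inv G *v axis i 1) = v $ i *\<^sub>R (matrix_inv G *v axis i 1)"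
    unfolding matrix_vector_mul_assoc[symmetric] G D by (rule matrix_vector_mult_scaleR)
  show "matrix_inv G *v axis i 1 \<noteq> 0"
    using G by (metis axis_eq_0_iff matrix_vector_mult_0_right zero_neq_one)
qed

definition cyclic3 :: "nat \<Rightarrow> 'a \<Rightarrow> 'a \<Rightarrow> 'a \<Rightarrow> 'a" where
  "cyclic3 k a b c = (if k mod 3 = 0 then a else if k mod 3 = 1 then b else c)"

theorem theorem1p9:
  fixes \<Omega> :: "(real^3) set" and q1 q2 q3 l1 l2 l3 :: real and G A M N :: "real^3^3"
  assumes "\<Omega> \<noteq> {}" and "bounded \<Omega>" and "open \<Omega>"
    and "q1 \<in> {0<..<1}" and "q2 \<in> {0<..<1}" and "q3 \<in> {0<..<1}"
    and "invertible G"
    and "l1 = 0" and "l2 = 1 / (1 - q1)" and "l3 = q2 / (q1 + q2 - q1 * q2)"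
    and "A = (1 / q3) *\<^sub>R
      ((1 - (1 - q1) * (1 - q2) * (1 - q3)) *\<^sub>R
          (matrix_inv G ** diag_matrix (vector [l1, l2, l3]) ** G)
        - (q2 * (1 - q3)) *\<^sub>R mat 1)"
    and "invertible N"
  shows "non_rigid_approx \<Omega> {M, N + M, N ** A + M}"
proof -
  have q: "0 < q1" "q1 < 1" "0 < q2" "q2 < 1" "0 < q3" "q3 < 1" using assms(4-6) by auto
  define \<Lambda> where "\<Lambda> = matrix_inv G ** diag_matrix (vector [l1, l2, l3]) ** G"
  define s where "s = 1 - (1 - q1) * (1 - q2) * (1 - q3)"
  define v :: "3 \<Rightarrow> real^3" where "v = (\<lambda>i. matrix_inv G *v axis i 1)"
  have v_nz: "v i \<noteq> 0" for i unfolding v_def by (rule matrix_inv_eigenvector(2)[OF assms(7)])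
  have \<Lambda>v: "\<Lambda> *v v 1 = 0" "\<Lambda> *v v 2 = l2 *\<^sub>R v 2" "\<Lambda> *v v 3 = l3 *\<^sub>R v 3"
    unfolding \<Lambda>_def v_def by (simp_all add: matrix_inv_eigenvector(1)[OF assms(7)] vector_3 assms(8))
  have A_eq: "A = (1 / q3) *\<^sub>R (s *\<^sub>R \<Lambda> - (q2 * (1 - q3)) *\<^sub>R mat 1)"
    by (simp add: assms(11) s_def \<Lambda>_def)
  then have bary: "s *\<^sub>R \<Lambda> = q3 *\<^sub>R A + (q2 * (1 - q3)) *\<^sub>R mat 1" using q by simp
  have t: "q1 + q2 - q1 * q2 > 0"
    using mult_strict_right_mono[OF q(2,3)] q by linarith
  have Av: "A *v w = (1 / q3) *\<^sub>R (s *\<^sub>R (\<Lambda> *v w) - (q2 * (1 - q3)) *\<^sub>R w)" for w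
    by (simp add: A_eq matrix_vector_mult_diff_rdistrib scaleR_matrix_vector_assoc[symmetric])
  have l3_eq: "s * l3 - q2 * (1 - q3) = q3 * l3" "q2 + (1 - q2) * ((1 - q1) * l3) = l3"
    using t by (simp_all add: assms(10) s_def divide_simps) (simp_all add: algebra_simps)
  have Av3: "A *v v 3 = l3 *\<^sub>R v 3"
    unfolding Av \<Lambda>v using l3_eq(1) q by (simp flip: scaleR_diff_left)
  have Av1: "A *v v 1 = (- (q2 * (1 - q3)) / q3) *\<^sub>R v 1"
    unfolding Av \<Lambda>v by (simp flip: scaleR_minus_left)
  define P1 where "P1 = N ** \<Lambda> + M"
  define P3 where "P3 = q1 *\<^sub>R M + (1 - q1) *\<^sub>R P1"
  define P2 where "P2 = q2 *\<^sub>R (N + M) + (1 - q2) *\<^sub>R P3"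
  \<comment> \<open>The splittings lead from \<open>P1\<close> back to \<open>P1\<close>, because of the formula for \<open>A\<close>.\<close>
  have "P1 = q3 *\<^sub>R (N ** A + M) + (1 - q3) *\<^sub>R P2"
  proof -
    have "s *\<^sub>R (N ** \<Lambda>) = q3 *\<^sub>R (N ** A) + (q2 * (1 - q3)) *\<^sub>R N"
      unfolding matrix_eq
      using q by (simp add: Av matrix_vector_mult_add_rdistrib matrix_vector_mul_assoc[symmetric]
          scaleR_matrix_vector_assoc[symmetric] matrix_vector_mult_diff_distrib matrix_vector_mult_scaleR
          scaleR_diff_right)
    then show ?thesis unfolding P2_def P3_def P1_def s_def by (simp add: algebra_simps)
  qed
  note split = this P2_def P3_def
  have Nv: "N *v w = 0 \<longleftrightarrow> w = 0" for w
  proof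
    assume "N *v w = 0"
    moreover obtain N' where "N' ** N = mat 1" using assms(12) unfolding invertible_def by blast
    ultimately show "w = 0" by (metis matrix_vector_mul_assoc matrix_vector_mul_lid matrix_vector_mult_0_right)
  qed simp
  have act: "(N ** \<Lambda>) *v v 1 = 0" "(N ** \<Lambda>) *v v 2 = l2 *\<^sub>R (N *v v 2)" "(N ** \<Lambda>) *v v 3 = l3 *\<^sub>R (N *v v 3)"
    "(N ** A) *v v 3 = l3 *\<^sub>R (N *v v 3)" "(N ** A) *v v 1 = (- (q2 * (1 - q3)) / q3) *\<^sub>R (N *v v 1)"
    by (simp_all only: matrix_vector_mul_assoc[symmetric] \<Lambda>v Av3 Av1 matrix_vector_mult_scaleR matrix_vector_mult_0_right)
  \<comment> \<open>Each mixed pair agrees on one eigenvector, which becomes the normal of the layers.\<close>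
  have comp3: "(P2 - (N ** A + M)) *v v 3 = 0"
  proof -
    have eq: "P2 - (N ** A + M) = q2 *\<^sub>R N + ((1 - q2) * (1 - q1)) *\<^sub>R (N ** \<Lambda>) - N ** A"
      by (simp add: P2_def P3_def P1_def algebra_simps)
    have "(P2 - (N ** A + M)) *v v 3 = (q2 + (1 - q2) * ((1 - q1) * l3) - l3) *\<^sub>R (N *v v 3)"
      unfolding eq by (simp add: matrix_vector_mult_add_rdistrib matrix_vector_mult_diff_rdistrib
          scaleR_matrix_vector_assoc[symmetric] act scaleR_add_left scaleR_diff_left)
    then show ?thesis by (simp add: l3_eq(2))
  qed
  have comp2: "(P3 - (N + M)) *v v 2 = 0"
  proof -
    have eq: "P3 - (N + M) = (1 - q1) *\<^sub>R (N ** \<Lambda>) - N"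
      by (simp add: P3_def P1_def algebra_simps)
    have "(P3 - (N + M)) *v v 2 = ((1 - q1) * l2 - 1) *\<^sub>R (N *v v 2)"
      unfolding eq by (simp add: matrix_vector_mult_diff_rdistrib scaleR_matrix_vector_assoc[symmetric] act algebra_simps)
    then show ?thesis using q by (simp add: assms(9))
  qed
  have comp1: "(P1 - M) *v v 1 = 0" by (simp add: P1_def act)
  define R where "R = norm P1 + norm P2 + norm P3 + norm (N ** A + M) + norm (N + M) + norm M"
  interpret infinite_laminate "{M, N + M, N ** A + M}" "\<lambda>k. cyclic3 k (N ** A + M) (N + M) M"
    "\<lambda>k. cyclic3 k P1 P2 P3" "\<lambda>k. cyclic3 k (v 3) (v 2) (v 1)" "\<lambda>k. cyclic3 k q3 q2 q1"
    "min q1 (min q2 q3)" R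
  proof
    fix k
    show "cyclic3 k (N ** A + M) (N + M) M \<in> {M, N + M, N ** A + M}" by (simp add: cyclic3_def)
    show "norm (cyclic3 k (N ** A + M) (N + M) M) \<le> R" "norm (cyclic3 k P1 P2 P3) \<le> R"
      by (simp_all add: cyclic3_def R_def)
    show "cyclic3 k (v 3) (v 2) (v 1) \<noteq> 0" using v_nz by (simp add: cyclic3_def)
    show "0 < min q1 (min q2 q3)" using q by simp
    show "min q1 (min q2 q3) \<le> cyclic3 k q3 q2 q1" "cyclic3 k q3 q2 q1 < 1"
      using q by (auto simp: cyclic3_def min_def)
    have "k mod 3 < 3" by simp
    then have k3: "k mod 3 = 0 \<or> k mod 3 = 1 \<or> k mod 3 = 2" by linarith
    then show "cyclic3 k P1 P2 P3 = cyclic3 k q3 q2 q1 *\<^sub>R cyclic3 k (N ** A + M) (N + M) M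
        + (1 - cyclic3 k q3 q2 q1) *\<^sub>R cyclic3 (Suc k) P1 P2 P3"
      by (elim disjE) (simp_all add: cyclic3_def mod_Suc, rule split(1), rule split(2), rule split(3))
    show "(cyclic3 (Suc k) P1 P2 P3 - cyclic3 k (N ** A + M) (N + M) M) *v cyclic3 k (v 3) (v 2) (v 1) = 0"
      using k3 comp1 comp2 comp3 by (auto simp: cyclic3_def mod_Suc)
  qed
  have "P1 \<notin> {M, N + M, N ** A + M}"
  proof
    assume "P1 \<in> {M, N + M, N ** A + M}"
    then consider "N ** \<Lambda> = 0" | "N ** \<Lambda> = N" | "N ** \<Lambda> = N ** A" by (auto simp: P1_def)
    then show False
    proof cases
      case 1
      then have "l2 *\<^sub>R (N *v v 2) = 0" using act(2) by simp
      then show False using Nv v_nz[of 2] q by (simp add: assms(9))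
    next
      case 2
      then have "N *v v 1 = 0" using act(1) by simp
      then show False using Nv v_nz[of 1] by simp
    next
      case 3
      then have "(- (q2 * (1 - q3)) / q3) *\<^sub>R (N *v v 1) = 0" using act(1,5) by metis
      then show False using Nv v_nz[of 1] q by simp
    qed
  qed
  then show ?thesis
    using non_rigid[OF assms(3,2,1)] by (simp add: cyclic3_def)
qed

end
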